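(* Let $(X,\mu)$ be a non-atomic probability measure space, $\mathcal{T}$ a tree on $X$, $\mathcal{M}=\mathcal{M}_{\mathcal{T}}$ the associated maximal operator, $p>1$ and $k=p/(p-1)$. For $F>0$, $0<f\le kF$ and $\lambda>0$ define $$B_1(f,F,\lambda)=\sup\Big\{\mu(\{\mathcal{M}\phi\ge\lambda\}) : \phi\ge0,\ \int_X\phi\,d\mu=f,\ \|\phi\|_{p,\infty}=F\Big\}.$$ Then $B_1(f,F,\lambda)=\min(1,f/\lambda,k^pF^p/\lambda^p)$; that is, $B_1=1$ for $0<\lambda<f$, $B_1=f/\lambda$ for $f\le\lambda<(k^pF^p/f)^{1/(p-1)}$, and $B_1=k^pF^p/\lambda^p$ for $\lambda\ge(k^pF^p/f)^{1/(p-1)}$.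
   Context: A tree on $(X,\mu)$ is a set $\mathcal{T}$ of measurable subsets of $X$ such that: (i) $X\in\mathcal{T}$ and $\mu(I)>0$ for every $I\in\mathcal{T}$; (ii) every $I\in\mathcal{T}$ has an associated finite subset $\mathcal{C}(I)\subseteq\mathcal{T}$ with at least two elements, whose elements are pairwise almost disjoint (i.e. intersections have measure zero) subsets of $I$ with union $I$; (iii) $\mathcal{T}=\bigcup_{m\ge0}\mathcal{T}_{(m)}$ where $\mathcal{T}_{(0)}=\{X\}$ and $\mathcal{T}_{(m+1)}=\bigcup_{I\in\mathcal{T}_{(m)}}\mathcal{C}(I)$; (iv) $\lim_{m\to\infty}\sup_{I\in\mathcal{T}_{(m)}}\mu(I)=0$. The associated maximal operator is $\mathcal{M}_{\mathcal{T}}\phi(x)=\sup\{\frac{1}{\mu(I)}\int_I|\phi|\,d\mu : x\in I\in\mathcal{T}\}$ for $\phi\in L^1(X,\mu)$. $\|\phi\|_{p,\infty}=\sup\{\lambda\,\mu(\{|\phi|>\lambda\})^{1/p}:\lambda>0\}$. *)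

theory Defs
  imports "HOL-Probability.Probability"
begin

definition non_atomic :: "'a measure \<Rightarrow> bool" where
  "non_atomic M \<longleftrightarrow> (\<forall>A\<in>sets M. measure M A > 0 \<longrightarrow>
      (\<exists>B\<in>sets M. B \<subseteq> A \<and> 0 < measure M B \<and> measure M B < measure M A))"

primrec tree_level :: "('a set \<Rightarrow> 'a set set) \<Rightarrow> 'a set \<Rightarrow> nat \<Rightarrow> 'a set set" where
  "tree_level C X 0 = {X}"
| "tree_level C X (Suc m) = (\<Union>I\<in>tree_level C X m. C I)"

definition is_tree :: "'a measure \<Rightarrow> 'a set set \<Rightarrow> ('a set \<Rightarrow> 'a set set) \<Rightarrow> bool" where
  "is_tree M T C \<longleftrightarrow>
     T \<subseteq> sets M \<and> space M \<in> T \<and> (\<forall>I\<in>T. measure M I > 0) \<and>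
     (\<forall>I\<in>T. finite (C I) \<and> card (C I) \<ge> 2 \<and> C I \<subseteq> T \<and> (\<forall>J\<in>C I. J \<subseteq> I) \<and>
        (\<forall>J\<in>C I. \<forall>K\<in>C I. J \<noteq> K \<longrightarrow> measure M (J \<inter> K) = 0) \<and> \<Union>(C I) = I) \<and>
     T = (\<Union>m. tree_level C (space M) m) \<and>
     (\<lambda>m. Sup ((measure M) ` tree_level C (space M) m)) \<longlonglongrightarrow> 0"

definition tree_maximal :: "'a measure \<Rightarrow> 'a set set \<Rightarrow> ('a \<Rightarrow> real) \<Rightarrow> 'a \<Rightarrow> ennreal" where
  "tree_maximal M T \<phi> x =
     (SUP I\<in>{I\<in>T. x \<in> I}. ennreal ((1 / measure M I) * (\<integral>y\<in>I. \<bar>\<phi> y\<bar> \<partial>M)))"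

definition weak_Lp_norm :: "'a measure \<Rightarrow> real \<Rightarrow> ('a \<Rightarrow> real) \<Rightarrow> ereal" where
  "weak_Lp_norm M p \<phi> =
     (SUP t\<in>{0<..}. ereal (t * (measure M {x\<in>space M. \<bar>\<phi> x\<bar> > t}) powr (1/p)))"

definition B1 :: "'a measure \<Rightarrow> 'a set set \<Rightarrow> real \<Rightarrow> real \<Rightarrow> real \<Rightarrow> real \<Rightarrow> real" where
  "B1 M T p f F lam = Sup {measure M {x\<in>space M. tree_maximal M T \<phi> x \<ge> ennreal lam} | \<phi>.
       integrable M \<phi> \<and> (\<forall>x\<in>space M. \<phi> x \<ge> 0) \<and> (\<integral>x. \<phi> x \<partial>M) = f \<and>
       weak_Lp_norm M p \<phi> = ereal F}"

end

theory Submission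
  imports Defs
begin

text \<open>For \<open>c < lam\<close>, stopping the descent through the tree as soon as an average exceeds \<open>c\<close> gives
  increasing sets \<open>A\<close> that exhaust a superset of \<open>{M\<phi> \<ge> lam}\<close> and satisfy
  \<open>c \<mu>(A) \<le> \<integral>\<^sub>A |\<phi>|\<close>; the right side is at most \<open>f\<close> and, by the
  layer cake formula, at most \<open>k F \<mu>(A) powr (1 - 1/p)\<close>. Letting \<open>c\<close> tend to \<open>lam\<close> gives the upper bound \<open>b\<close>.

  Conversely, since the mesh of the tree tends to zero, some union of elements of a single level has measure
  \<open>s \<in> (b - \<epsilon>, b]\<close>. There is a variable \<open>V\<close>, uniform on \<open>[0,1]\<close>, whose restriction to each of these elements
  is uniform on \<open>[0,s]\<close>. The function \<open>\<phi> = F V powr (-1/p)\<close>, cut off to \<open>0\<close> where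
  \<open>V > \<sigma>\<close> with \<open>\<sigma>\<close> fixed by \<open>\<integral>\<phi> = f\<close>, has weak norm \<open>F\<close> and average at least \<open>lam\<close> on each of the chosen elements.\<close>

section \<open>Trees\<close>

text \<open>The defining recursion adds the last generation; this form splits off the first one, as
  an induction that starts at the root requires.\<close>

lemma tree_level_Suc_children: "tree_level C I (Suc m) = (\<Union>J\<in>C I. tree_level C J m)"
  by (induction m) auto

lemma
  assumes "is_tree M T C"
  shows is_tree_space: "space M \<in> T"
    and is_tree_sets: "I \<in> T \<Longrightarrow> I \<in> sets M"
    and is_tree_pos: "I \<in> T \<Longrightarrow> measure M I > 0"
    and is_tree_finite: "I \<in> T \<Longrightarrow> finite (C I)"
    and is_tree_children: "I \<in> T \<Longrightarrow> J \<in> C I \<Longrightarrow> J \<in> T"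
    and is_tree_child_subset: "I \<in> T \<Longrightarrow> J \<in> C I \<Longrightarrow> J \<subseteq> I"
    and is_tree_null: "I \<in> T \<Longrightarrow> J \<in> C I \<Longrightarrow> K \<in> C I \<Longrightarrow> J \<noteq> K \<Longrightarrow> measure M (J \<inter> K) = 0"
    and is_tree_Union: "I \<in> T \<Longrightarrow> \<Union>(C I) = I"
    and is_tree_levels: "T = (\<Union>m. tree_level C (space M) m)"
    and is_tree_mesh: "(\<lambda>m. Sup (measure M ` tree_level C (space M) m)) \<longlonglongrightarrow> 0"
proof -
  note * = assms[unfolded is_tree_def]
  show "space M \<in> T" using * by blast
  show "T = (\<Union>m. tree_level C (space M) m)" using * by (elim conjE)
  show "(\<lambda>m. Sup (measure M ` tree_level C (space M) m)) \<longlonglongrightarrow> 0" using * by (elim conjE)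
  have **: "T \<subseteq> sets M" using * by (elim conjE)
  have pos: "\<forall>I\<in>T. measure M I > 0" using * by (elim conjE)
  have ch: "\<forall>I\<in>T. finite (C I) \<and> card (C I) \<ge> 2 \<and> C I \<subseteq> T \<and> (\<forall>J\<in>C I. J \<subseteq> I) \<and>
        (\<forall>J\<in>C I. \<forall>K\<in>C I. J \<noteq> K \<longrightarrow> measure M (J \<inter> K) = 0) \<and> \<Union>(C I) = I"
    using * by (elim conjE)
  show "I \<in> T \<Longrightarrow> I \<in> sets M" using ** by blast
  show "I \<in> T \<Longrightarrow> measure M I > 0" using pos by blast
  assume I: "I \<in> T"
  note I = bspec[OF ch I]
  show "finite (C I)" using I by (elim conjE)
  show "\<Union>(C I) = I" using I by (elim conjE)
  show "J \<in> C I \<Longrightarrow> J \<in> T" "J \<in> C I \<Longrightarrow> J \<subseteq> I" using I by blast+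
  show "J \<in> C I \<Longrightarrow> K \<in> C I \<Longrightarrow> J \<noteq> K \<Longrightarrow> measure M (J \<inter> K) = 0" using I by blast
qed

lemma tree_level_subset:
  assumes "is_tree M T C" "I \<in> T" "J \<in> tree_level C I m"
  shows "J \<in> T \<and> J \<subseteq> I"
  using assms(2,3)
proof (induction m arbitrary: J)
  case (Suc m)
  then obtain K where "K \<in> tree_level C I m" "J \<in> C K" by auto
  with Suc is_tree_children[OF assms(1)] is_tree_child_subset[OF assms(1)] show ?case by blast
qed auto

lemma finite_tree_level:
  assumes "is_tree M T C" "I \<in> T"
  shows "finite (tree_level C I m)"
proof (induction m)
  case (Suc m)
  then show ?case
    using tree_level_subset[OF assms] is_tree_finite[OF assms(1)] by (auto intro!: finite_UN_I)
qed auto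

text \<open>All levels are finite. Countability allows the maximal function to be written as a
  countable supremum and the tree to be enumerated by digit positions.\<close>

lemma countable_tree:
  assumes "is_tree M T C"
  shows "countable T"
proof -
  have "countable (\<Union>m. tree_level C (space M) m)"
    using finite_tree_level[OF assms is_tree_space[OF assms]]
    by (intro countable_UN) (auto intro: countable_finite)
  then show ?thesis using is_tree_levels[OF assms] by argo
qed

lemma Union_tree_level:
  assumes "is_tree M T C" "I \<in> T"
  shows "\<Union>(tree_level C I m) = I"
proof (induction m)
  case (Suc m)
  have "\<Union>(tree_level C I (Suc m)) = (\<Union>J\<in>tree_level C I m. \<Union>(C J))" by auto
  also have "\<dots> = \<Union>(tree_level C I m)"
    using tree_level_subset[OF assms] is_tree_Union[OF assms(1)] by auto
  finally show ?case using Suc by simp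
qed auto

text \<open>Siblings overlap in a null set by the tree axioms; elements with different parents
  overlap inside the intersection of the parents, which is null by induction.\<close>

lemma tree_level_null:
  assumes "finite_measure M" "is_tree M T C" "J \<in> tree_level C (space M) m"
    "K \<in> tree_level C (space M) m" "J \<noteq> K"
  shows "measure M (J \<inter> K) = 0"
  using assms(3-)
proof (induction m arbitrary: J K)
  case (Suc m)
  interpret finite_measure M by fact
  obtain J' K' where JK: "J' \<in> tree_level C (space M) m" "J \<in> C J'"
    "K' \<in> tree_level C (space M) m" "K \<in> C K'"
    using Suc.prems by auto
  have T: "J' \<in> T" "K' \<in> T"
    using JK tree_level_subset[OF assms(2) is_tree_space[OF assms(2)]] by auto
  show ?case
  proof (cases "J' = K'")
    case True
    then show ?thesis using is_tree_null[OF assms(2)] JK T Suc.prems by blast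
  next
    case False
    then have "measure M (J' \<inter> K') = 0" using Suc.IH JK by blast
    moreover have "measure M (J \<inter> K) \<le> measure M (J' \<inter> K')"
      using is_tree_child_subset[OF assms(2)] JK T is_tree_sets[OF assms(2)]
      by (intro finite_measure_mono) blast+
    ultimately show ?thesis by (metis measure_le_0_iff)
  qed
qed auto

text \<open>The mesh condition for single elements. A real \<open>Sup\<close> bounds its members
  only if the set is bounded above, which holds here because a level is finite.\<close>

lemma tree_level_measure_less:
  assumes "is_tree M T C" "0 < \<delta>"
  obtains m where "\<And>J. J \<in> tree_level C (space M) m \<Longrightarrow> measure M J < \<delta>"
proof -
  have "\<forall>\<^sub>F m in sequentially. Sup (measure M ` tree_level C (space M) m) < \<delta>"
    using order_tendstoD(2)[OF is_tree_mesh[OF assms(1)] assms(2)] .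
  then obtain m where m: "Sup (measure M ` tree_level C (space M) m) < \<delta>"
    by (auto simp: eventually_sequentially)
  have "measure M J < \<delta>" if "J \<in> tree_level C (space M) m" for J
  proof (rule le_less_trans[OF cSup_upper m])
    show "measure M J \<in> measure M ` tree_level C (space M) m" using that by blast
    show "bdd_above (measure M ` tree_level C (space M) m)"
      using finite_tree_level[OF assms(1) is_tree_space[OF assms(1)]] by simp
  qed
  then show thesis using that by blast
qed

text \<open>Outside finitely many null overlaps a point lies in at most one \<open>A i\<close>. The
  value type is left open because both real and \<open>ennreal\<close> indicators occur.\<close>

lemma AE_indicator_UN_eq_sum:
  assumes "finite I" and "\<And>i j. i \<in> I \<Longrightarrow> j \<in> I \<Longrightarrow> i \<noteq> j \<Longrightarrow> AE x in M. \<not> (x \<in> A i \<and> x \<in> A j)"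
  shows "AE x in M. indicator (\<Union>i\<in>I. A i) x = (\<Sum>i\<in>I. indicator (A i) x :: 'b::semiring_1)"
proof -
  have "AE x in M. \<forall>i\<in>I. \<forall>j\<in>I. i \<noteq> j \<longrightarrow> \<not> (x \<in> A i \<and> x \<in> A j)"
    using assms by (auto intro!: AE_finite_allI)
  then show ?thesis
  proof eventually_elim
    case (elim x)
    show ?case
    proof (cases "\<exists>i\<in>I. x \<in> A i")
      case True
      then obtain i where i: "i \<in> I" "x \<in> A i" by blast
      have "(\<Sum>j\<in>I. indicator (A j) x) = (\<Sum>j\<in>I. if j = i then 1 else 0 :: 'b)"
        using elim i by (intro sum.cong) (auto simp: indicator_def)
      then show ?thesis using i assms(1) by (auto simp: indicator_def)
    qed (auto simp: indicator_def)
  qed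
qed

section \<open>The upper bound\<close>

text \<open>A stopping time truncated at depth \<open>n\<close>: each branch ends at its first
  element satisfying \<open>P\<close>, and a branch that has not ended after \<open>n\<close>
  generations is discarded. Recursion on the depth avoids selecting maximal elements and turns the
  estimates into inductions.\<close>

primrec stopped :: "('a set \<Rightarrow> 'a set set) \<Rightarrow> ('a set \<Rightarrow> bool) \<Rightarrow> nat \<Rightarrow> 'a set \<Rightarrow> 'a set" where
  "stopped C P 0 I = (if P I then I else {})"
| "stopped C P (Suc n) I = (if P I then I else (\<Union>J\<in>C I. stopped C P n J))"

lemma stopped_subset: "is_tree M T C \<Longrightarrow> I \<in> T \<Longrightarrow> stopped C P n I \<subseteq> I"
proof (induction n arbitrary: I)
  case (Suc n)
  then show ?case
    using is_tree_children[OF Suc.prems(1)] is_tree_child_subset[OF Suc.prems(1)]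
    by (simp; blast)
qed simp

lemma stopped_sets: "is_tree M T C \<Longrightarrow> I \<in> T \<Longrightarrow> stopped C P n I \<in> sets M"
proof (induction n arbitrary: I)
  case 0
  then show ?case using is_tree_sets by auto
next
  case (Suc n)
  have "(\<Union>J\<in>C I. stopped C P n J) \<in> sets M"
    using Suc is_tree_children[OF Suc.prems(1)] is_tree_finite[OF Suc.prems(1)]
    by (intro sets.finite_UN) auto
  then show ?case using is_tree_sets Suc.prems by auto
qed

text \<open>A larger depth only gives the discarded branches another chance to stop.\<close>

lemma stopped_mono: "is_tree M T C \<Longrightarrow> I \<in> T \<Longrightarrow> stopped C P n I \<subseteq> stopped C P (Suc n) I"
proof (induction n arbitrary: I)
  case (Suc n)
  have "(\<Union>J\<in>C I. stopped C P n J) \<subseteq> (\<Union>J\<in>C I. stopped C P (Suc n) J)"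
    using Suc.IH[OF Suc.prems(1) is_tree_children[OF Suc.prems]] by (intro UN_mono) auto
  then show ?case unfolding stopped.simps(2)[of C P "Suc n" I] stopped.simps(2)[of C P n I] by (cases "P I") (simp_all only: if_True if_False order_refl)
qed simp

text \<open>The branch leading to \<open>J\<close> ends within \<open>m\<close> steps, either at
  \<open>J\<close> or earlier at an ancestor, and an ancestor contains \<open>J\<close>.\<close>

lemma level_subset_stopped:
  assumes "is_tree M T C" "I \<in> T" "J \<in> tree_level C I m" "P J"
  shows "J \<subseteq> stopped C P m I"
  using assms(2-)
proof (induction m arbitrary: I)
  case (Suc m)
  then obtain K where K: "K \<in> C I" "J \<in> tree_level C K m"
    using tree_level_Suc_children by (metis UN_E)
  have "J \<subseteq> stopped C P m K"
    using Suc.IH[OF is_tree_children[OF assms(1) Suc.prems(1) K(1)] K(2)] Suc.prems by blast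
  moreover have "J \<subseteq> I" using tree_level_subset[OF assms(1) Suc.prems(1,2)] by blast
  ultimately show ?case using K by auto
qed simp

text \<open>Induction on the depth: at a stopping element this is the hypothesis on
  \<open>P\<close>, elsewhere the inequalities for the children are added up.\<close>

lemma stopped_integral_ge:
  fixes \<psi> :: "'a \<Rightarrow> real"
  assumes "finite_measure M" "is_tree M T C" "integrable M \<psi>" "0 \<le> c"
    and P: "\<And>I. I \<in> T \<Longrightarrow> P I \<Longrightarrow> c * measure M I \<le> (\<integral>x\<in>I. \<psi> x \<partial>M)"
    and "I \<in> T"
  shows "c * measure M (stopped C P n I) \<le> (\<integral>x\<in>stopped C P n I. \<psi> x \<partial>M)"
  using assms(6)
proof (induction n arbitrary: I)
  case 0
  then show ?case using P by (simp add: set_lebesgue_integral_def)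
next
  case (Suc n)
  interpret finite_measure M by fact
  note tree = assms(2)
  show ?case
  proof (cases "P I")
    case False
    let ?S = "stopped C P n"
    have meas: "?S J \<in> sets M" if "J \<in> C I" for J
      using stopped_sets[OF tree is_tree_children[OF tree Suc.prems that]] .
    have AE: "AE x in M. \<not> (x \<in> ?S J \<and> x \<in> ?S K)" if "J \<in> C I" "K \<in> C I" "J \<noteq> K" for J K
    proof -
      have T: "J \<in> T" "K \<in> T" using that is_tree_children[OF tree Suc.prems] by auto
      have "J \<inter> K \<in> null_sets M"
        using is_tree_null[OF tree Suc.prems that] T is_tree_sets[OF tree]
        by (intro null_setsI) (auto simp: emeasure_eq_measure)
      then show ?thesis
        using stopped_subset[OF tree T(1)] stopped_subset[OF tree T(2)]
        by (intro AE_I'[of "J \<inter> K"]) blast+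
    qed
    \<comment> \<open>Subadditivity suffices for the measure. The integral side below needs almost
      disjointness, since overlaps would be counted several times.\<close>
    have "c * measure M (\<Union>J\<in>C I. ?S J) \<le> c * (\<Sum>J\<in>C I. measure M (?S J))"
      using assms(4) is_tree_finite[OF tree Suc.prems] meas
      by (intro mult_left_mono finite_measure_subadditive_finite) auto
    also have "\<dots> \<le> (\<Sum>J\<in>C I. \<integral>x\<in>?S J. \<psi> x \<partial>M)"
      unfolding sum_distrib_left
      using Suc.IH is_tree_children[OF tree Suc.prems] by (intro sum_mono) auto
    also have "\<dots> = (\<integral>x. (\<Sum>J\<in>C I. indicator (?S J) x * \<psi> x) \<partial>M)"
      using meas assms(3) unfolding set_lebesgue_integral_def
      by (subst Bochner_Integration.integral_sum) (auto intro!: integrable_real_mult_indicator simp: mult.commute)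
    also have "\<dots> = (\<integral>x\<in>(\<Union>J\<in>C I. ?S J). \<psi> x \<partial>M)"
      unfolding set_lebesgue_integral_def
    proof (intro integral_cong_AE)
      have "AE x in M. indicator (\<Union>J\<in>C I. ?S J) x = (\<Sum>J\<in>C I. indicator (?S J) x :: real)"
        by (rule AE_indicator_UN_eq_sum[OF is_tree_finite[OF tree Suc.prems] AE])
      then show "AE x in M. (\<Sum>J\<in>C I. indicator (?S J) x * \<psi> x) = indicator (\<Union>J\<in>C I. ?S J) x *\<^sub>R \<psi> x"
        by eventually_elim (simp add: sum_distrib_right)
      show "(\<lambda>x. \<Sum>J\<in>C I. indicator (?S J) x * \<psi> x) \<in> borel_measurable M"
        using meas assms(3)
        by (intro borel_measurable_sum borel_measurable_times borel_measurable_indicator) auto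
      show "(\<lambda>x. indicator (\<Union>J\<in>C I. ?S J) x *\<^sub>R \<psi> x) \<in> borel_measurable M"
        using meas assms(3) is_tree_finite[OF tree Suc.prems]
        by (intro borel_measurable_scaleR borel_measurable_indicator sets.finite_UN) auto
    qed
    finally show ?thesis using False by simp
  qed (use P Suc in simp)
qed

section \<open>Layer cake formula and integrals of weak L^p functions\<close>

text \<open>\<open>(F / t) powr p\<close> is the bound that weak norm \<open>F\<close> puts on the
  distribution function; it is integrable at infinity because \<open>p > 1\<close>.\<close>

lemma nn_integral_powr_tail:
  fixes F p \<tau> :: real
  assumes "1 < p" "0 < \<tau>" "0 \<le> F"
  shows "(\<integral>\<^sup>+t. ennreal ((F / t) powr p) * indicator {\<tau>..} t \<partial>lborel)
    = ennreal (F powr p * \<tau> powr (1 - p) / (p - 1))"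
proof -
  have "((\<lambda>t. F powr p * t powr (-p)) has_integral F powr p * (-(\<tau> powr (-p+1)) / (-p+1))) {\<tau>..}"
    using assms by (intro has_integral_mult_right has_integral_powr_to_inf) auto
  also have "-(\<tau> powr (-p+1)) / (-p+1) = \<tau> powr (1 - p) / (p - 1)"
    using minus_divide_divide[of "\<tau> powr (1 - p)" "p - 1"] by simp
  finally have "((\<lambda>t. (F / t) powr p) has_integral F powr p * \<tau> powr (1 - p) / (p - 1)) {\<tau>..}"
    using assms by (subst (asm) has_integral_cong[where g="\<lambda>t. (F / t) powr p"])
      (auto simp: powr_divide powr_minus divide_simps)
  then show ?thesis
    by (intro nn_integral_has_integral_lebesgue') auto
qed

text \<open>For \<open>x\<close> in \<open>A\<close>, the value \<open>\<phi> x\<close> is the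
  length of the interval of all \<open>t\<close> with \<open>0 \<le> t < \<phi> x\<close>; Fubini
  exchanges the two integrations.\<close>

lemma nn_integral_layer_cake:
  fixes \<phi> :: "'a \<Rightarrow> real"
  assumes "sigma_finite_measure M" "\<phi> \<in> borel_measurable M" "\<And>x. x \<in> space M \<Longrightarrow> 0 \<le> \<phi> x"
    and "A \<in> sets M"
  shows "(\<integral>\<^sup>+x\<in>A. ennreal (\<phi> x) \<partial>M)
    = (\<integral>\<^sup>+t. emeasure M {x\<in>A. t < \<phi> x} * indicator {0..} t \<partial>lborel)"
proof -
  interpret sigma_finite_measure M by fact
  interpret pair_sigma_finite M lborel ..
  note [measurable] = assms(2,4)
  let ?h = "\<lambda>x t. (indicator {x\<in>A. t < \<phi> x} x * indicator {0..} t :: ennreal)"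
  have h: "?h x t = indicator {x\<in>space M. x \<in> A \<and> t < \<phi> x \<and> 0 \<le> t} x" if "x \<in> space M" for x t
    using that by (auto simp: indicator_def)
  have eq: "{x\<in>A. t < \<phi> x} = {x\<in>space M. x \<in> A \<and> t < \<phi> x}" for t
    using sets.sets_into_space[OF assms(4)] by auto
  have "(\<integral>\<^sup>+x\<in>A. ennreal (\<phi> x) \<partial>M) = (\<integral>\<^sup>+x. (\<integral>\<^sup>+t. ?h x t \<partial>lborel) \<partial>M)"
  proof (intro nn_integral_cong)
    fix x assume x: "x \<in> space M"
    have "(\<integral>\<^sup>+t. ?h x t \<partial>lborel) = (\<integral>\<^sup>+t. indicator A x * indicator {0..<\<phi> x} t \<partial>lborel)"
      by (intro nn_integral_cong) (auto simp: indicator_def)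
    also have "\<dots> = indicator A x * emeasure lborel {0..<\<phi> x}"
      by (subst nn_integral_cmult_indicator) auto
    finally show "ennreal (\<phi> x) * indicator A x = (\<integral>\<^sup>+t. ?h x t \<partial>lborel)"
      using assms(3)[OF x] by (simp add: mult.commute)
  qed
  also have "\<dots> = (\<integral>\<^sup>+t. (\<integral>\<^sup>+x. ?h x t \<partial>M) \<partial>lborel)"
    by (intro Fubini'[symmetric]) (measurable; simp add: eq)
  also have "\<dots> = (\<integral>\<^sup>+t. emeasure M {x\<in>A. t < \<phi> x} * indicator {0..} t \<partial>lborel)"
    by (intro nn_integral_cong, subst nn_integral_multc) (auto simp: eq intro!: nn_integral_indicator)
  finally show ?thesis .
qed

lemma weak_Lp_norm_leD:
  assumes "weak_Lp_norm M p \<phi> \<le> ereal F" "0 < t"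
  shows "t * measure M {x\<in>space M. \<bar>\<phi> x\<bar> > t} powr (1/p) \<le> F"
proof -
  have "ereal (t * measure M {x\<in>space M. \<bar>\<phi> x\<bar> > t} powr (1/p)) \<le> weak_Lp_norm M p \<phi>"
    unfolding weak_Lp_norm_def using assms(2) by (intro SUP_upper) auto
  then show ?thesis using assms(1) by (metis ereal_less_eq(3) order_trans)
qed

text \<open>On \<open>A\<close> the distribution function of \<open>\<bar>\<phi>\<bar>\<close> is at
  most \<open>measure M A\<close> and at most \<open>(F / t) powr p\<close>. The layer cake integral
  is split where these bounds cross; the parts contribute \<open>1\<close> and
  \<open>1 / (p - 1)\<close> times \<open>F * measure M A powr (1 - 1/p)\<close>.\<close>

lemma weak_Lp_set_integral_le:
  fixes \<phi> :: "'a \<Rightarrow> real"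
  assumes "finite_measure M" "integrable M \<phi>" "1 < p" "0 < F"
    and weak: "weak_Lp_norm M p \<phi> \<le> ereal F" and A: "A \<in> sets M"
  shows "(\<integral>x\<in>A. \<bar>\<phi> x\<bar> \<partial>M) \<le> p / (p - 1) * F * measure M A powr (1 - 1/p)"
proof -
  interpret finite_measure M by fact
  note [measurable] = A borel_measurable_integrable[OF assms(2)]
  let ?m = "measure M A"
  have le_m: "emeasure M {x\<in>A. t < \<bar>\<phi> x\<bar>} \<le> ennreal ?m" for t
    using emeasure_mono[of "{x\<in>A. t < \<bar>\<phi> x\<bar>}" A M] A by (auto simp: emeasure_eq_measure)
  have le_F: "emeasure M {x\<in>A. t < \<bar>\<phi> x\<bar>} \<le> ennreal ((F / t) powr p)" if "0 < t" for t
  proof -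
    let ?n = "measure M {x\<in>space M. t < \<bar>\<phi> x\<bar>}"
    have "?n powr (1/p) \<le> F / t"
      using weak_Lp_norm_leD[OF weak that] that by (simp add: field_simps)
    then have "(?n powr (1/p)) powr p \<le> (F / t) powr p"
      using assms(3) by (intro powr_mono2) auto
    then have "?n \<le> (F / t) powr p" using assms(3) by (simp add: powr_powr)
    moreover have "emeasure M {x\<in>A. t < \<bar>\<phi> x\<bar>} \<le> ennreal ?n"
      using sets.sets_into_space[OF A] unfolding emeasure_eq_measure[symmetric]
      by (intro emeasure_mono) auto
    ultimately show ?thesis using ennreal_leI order_trans by blast
  qed
  have "ennreal (\<integral>x\<in>A. \<bar>\<phi> x\<bar> \<partial>M) = (\<integral>\<^sup>+x. ennreal (indicator A x * \<bar>\<phi> x\<bar>) \<partial>M)"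
    unfolding set_lebesgue_integral_def real_scaleR_def using assms(2)
    by (subst nn_integral_eq_integral) (auto intro!: integrable_real_mult_indicator simp: mult.commute)
  also have "\<dots> = (\<integral>\<^sup>+x\<in>A. ennreal \<bar>\<phi> x\<bar> \<partial>M)"
    by (intro nn_integral_cong) (auto simp: indicator_def)
  also have "\<dots> = (\<integral>\<^sup>+t. emeasure M {x\<in>A. t < \<bar>\<phi> x\<bar>} * indicator {0..} t \<partial>lborel)"
    by (intro nn_integral_layer_cake) (use A in \<open>auto intro: sigma_finite_measure_axioms\<close>)
  also have "\<dots> \<le> ennreal (p / (p - 1) * F * ?m powr (1 - 1/p))"
  proof (cases "?m = 0")
    \<comment> \<open>A null set is treated apart because \<open>0 powr (-1/p) = 0\<close> would
      give the threshold \<open>\<tau>\<close> below the value \<open>0\<close>.\<close>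
    case True
    then have "emeasure M {x\<in>A. t < \<bar>\<phi> x\<bar>} = 0" for t using le_m[of t] by simp
    then show ?thesis by simp
  next
    case False
    then have m: "0 < ?m" by (simp add: zero_less_measure_iff)
    \<comment> \<open>The crossing point of the two bounds:
      \<open>(F / \<tau>) powr p = ?m\<close>.\<close>
    define \<tau> where "\<tau> = F * ?m powr (-1/p)"
    have \<tau>: "0 < \<tau>" using m assms(4) by (simp add: \<tau>_def)
    \<comment> \<open>The closed intervals share the point \<open>\<tau>\<close>, which is harmless
      for an upper bound.\<close>
    have "(\<integral>\<^sup>+t. emeasure M {x\<in>A. t < \<bar>\<phi> x\<bar>} * indicator {0..} t \<partial>lborel) \<le>
        (\<integral>\<^sup>+t. ennreal ?m * indicator {0..\<tau>} t + ennreal ((F / t) powr p) * indicator {\<tau>..} t \<partial>lborel)"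
    proof (intro nn_integral_mono)
      fix t
      show "emeasure M {x\<in>A. t < \<bar>\<phi> x\<bar>} * indicator {0..} t
        \<le> ennreal ?m * indicator {0..\<tau>} t + ennreal ((F / t) powr p) * indicator {\<tau>..} t"
        using le_m[of t] le_F[of t] \<tau> by (cases "t < \<tau>") (auto simp: indicator_def add_increasing)
    qed
    also have "\<dots> = ennreal ?m * ennreal \<tau> + ennreal (F powr p * \<tau> powr (1 - p) / (p - 1))"
      using \<tau> assms(3,4) by (subst nn_integral_add)
        (auto simp: nn_integral_powr_tail nn_integral_cmult_indicator)
    also have "\<dots> = ennreal (?m * \<tau> + F powr p * \<tau> powr (1 - p) / (p - 1))"
      using \<tau> assms(3) by (subst ennreal_plus) (auto simp: ennreal_mult)
    also have "?m * \<tau> + F powr p * \<tau> powr (1 - p) / (p - 1) = p / (p - 1) * F * ?m powr (1 - 1/p)"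
    proof -
      have 1: "?m * \<tau> = F * ?m powr (1 - 1/p)"
        using m by (simp add: \<tau>_def powr_diff powr_minus_divide)
      have "\<tau> powr (1 - p) = F powr (1 - p) * ?m powr (1 - 1/p)"
      proof -
        have "(-1/p) * (1 - p) = 1 - 1/p" using assms(3) by (simp add: field_simps)
        then show ?thesis using m assms(4) by (simp add: \<tau>_def powr_mult powr_powr)
      qed
      then have "F powr p * \<tau> powr (1 - p) = F * ?m powr (1 - 1/p)"
        using assms(4) by (simp add: powr_diff)
      then show ?thesis using 1 assms(3) by (simp add: field_simps)
    qed
    finally show ?thesis .
  qed
  finally show ?thesis using assms(3,4) by (simp add: ennreal_le_iff)
qed

section \<open>Superlevel sets of the maximal function\<close>

text \<open>Any bound \<open>b\<close> valid for all measurable sets on which the average of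
  \<open>\<bar>\<phi>\<bar>\<close> is at least \<open>c\<close> passes to the superlevel set: the
  stopped sets are of this kind and increase to a cover of it. Keeping \<open>b\<close> abstract
  serves both weak type estimates.\<close>

lemma tree_maximal_superlevel_le:
  fixes \<phi> :: "'a \<Rightarrow> real"
  assumes "finite_measure M" "is_tree M T C" "integrable M \<phi>" "0 < c" "c < lam"
    and b: "\<And>A. A \<in> sets M \<Longrightarrow> c * measure M A \<le> (\<integral>x\<in>A. \<bar>\<phi> x\<bar> \<partial>M) \<Longrightarrow> measure M A \<le> b"
  shows "measure M {x\<in>space M. tree_maximal M T \<phi> x \<ge> ennreal lam} \<le> b" (is "measure M ?E \<le> b")
proof -
  interpret finite_measure M by fact
  note tree = assms(2) and X = is_tree_space[OF assms(2)]
  define P where "P I \<longleftrightarrow> c < 1 / measure M I * (\<integral>x\<in>I. \<bar>\<phi> x\<bar> \<partial>M)" for I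
  define S where "S n = stopped C P n (space M)" for n
  have S: "S n \<in> sets M" for n unfolding S_def by (rule stopped_sets[OF tree X])
  have "incseq S" unfolding S_def by (intro incseq_SucI stopped_mono[OF tree X])
  have "measure M (S n) \<le> b" for n
  proof (rule b[OF S])
    show "c * measure M (S n) \<le> (\<integral>x\<in>S n. \<bar>\<phi> x\<bar> \<partial>M)"
      unfolding S_def
    proof (rule stopped_integral_ge[OF assms(1) tree _ _ _ X])
      fix I assume "I \<in> T" "P I"
      then show "c * measure M I \<le> (\<integral>x\<in>I. \<bar>\<phi> x\<bar> \<partial>M)"
        using is_tree_pos[OF tree] unfolding P_def by (simp add: field_simps less_imp_le)
    qed (use assms in auto)
  qed
  then have "measure M (\<Union>n. S n) \<le> b"
    using finite_Lim_measure_incseq[of S] \<open>incseq S\<close> S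
    by (intro LIMSEQ_le_const2[where X="\<lambda>n. measure M (S n)"]) auto
  moreover have "?E \<subseteq> (\<Union>n. S n)"
  proof
    fix x assume x: "x \<in> ?E"
    \<comment> \<open>The supremum need not be attained, but a strict inequality below it is
      witnessed by an element; this is where \<open>c < lam\<close> enters.\<close>
    have "ennreal c < tree_maximal M T \<phi> x"
    proof (rule less_le_trans)
      show "ennreal c < ennreal lam" using assms(4,5) by (simp add: ennreal_lessI)
    qed (use x in simp)
    then obtain I where I: "I \<in> T" "x \<in> I"
      "ennreal c < ennreal (1 / measure M I * (\<integral>x\<in>I. \<bar>\<phi> x\<bar> \<partial>M))"
      unfolding tree_maximal_def less_SUP_iff by auto
    have "P I" unfolding P_def using I(3) assms(4) by (simp add: ennreal_less_iff)
    moreover obtain m where "I \<in> tree_level C (space M) m"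
      using I(1) is_tree_levels[OF tree] by auto
    ultimately have "I \<subseteq> S m" unfolding S_def by (intro level_subset_stopped[OF tree X])
    then show "x \<in> (\<Union>n. S n)" using I by auto
  qed
  moreover have "(\<Union>n. S n) \<in> sets M" using S by auto
  ultimately show ?thesis using finite_measure_mono[of ?E "\<Union>n. S n"] by linarith
qed

text \<open>The integral over a subset is at most the total integral, so \<open>b = ?f / c\<close>
  is admissible; \<open>dense_le_bounded\<close> then lets \<open>c\<close> tend to
  \<open>lam\<close>.\<close>

lemma tree_maximal_weak_type:
  fixes \<phi> :: "'a \<Rightarrow> real"
  assumes "finite_measure M" "is_tree M T C" "integrable M \<phi>" "0 < lam"
  shows "lam * measure M {x\<in>space M. tree_maximal M T \<phi> x \<ge> ennreal lam} \<le> (\<integral>x. \<bar>\<phi> x\<bar> \<partial>M)"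
    (is "lam * measure M ?E \<le> ?f")
proof (cases "measure M ?E = 0")
  case False
  then have pos: "0 < measure M ?E" by (simp add: zero_less_measure_iff)
  have "lam \<le> ?f / measure M ?E"
  proof (rule dense_le_bounded[OF assms(4)])
    fix c assume c: "0 < c" "c < lam"
    have "measure M ?E \<le> ?f / c"
    proof (rule tree_maximal_superlevel_le[OF assms(1-3) c])
      fix A assume A: "A \<in> sets M" "c * measure M A \<le> (\<integral>x\<in>A. \<bar>\<phi> x\<bar> \<partial>M)"
      have "(\<integral>x\<in>A. \<bar>\<phi> x\<bar> \<partial>M) \<le> ?f"
        unfolding set_lebesgue_integral_def using A assms(3)
        by (intro integral_mono integrable_mult_indicator) (auto simp: indicator_def)
      then show "measure M A \<le> ?f / c" using A c by (simp add: field_simps)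
    qed
    then show "c \<le> ?f / measure M ?E" using c pos by (simp add: field_simps)
  qed
  then show ?thesis using pos by (simp add: field_simps)
qed simp

text \<open>The same limit with \<open>b = (?K / c) powr p\<close>, obtained by solving
  \<open>c * m \<le> ?K * m powr (1 - 1/p)\<close> for the measure \<open>m\<close>.\<close>

lemma tree_maximal_weak_Lp:
  fixes \<phi> :: "'a \<Rightarrow> real"
  assumes "finite_measure M" "is_tree M T C" "integrable M \<phi>" "0 < lam" "1 < p" "0 < F"
    and weak: "weak_Lp_norm M p \<phi> \<le> ereal F"
  shows "lam * measure M {x\<in>space M. tree_maximal M T \<phi> x \<ge> ennreal lam} powr (1/p) \<le> p / (p - 1) * F"
    (is "lam * measure M ?E powr (1/p) \<le> ?K")
proof (cases "measure M ?E = 0")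
  case False
  then have pos: "0 < measure M ?E" by (simp add: zero_less_measure_iff)
  have K: "0 < ?K" using assms by simp
  have "lam \<le> ?K / measure M ?E powr (1/p)"
  proof (rule dense_le_bounded[OF assms(4)])
    fix c assume c: "0 < c" "c < lam"
    have "measure M ?E \<le> (?K / c) powr p"
    proof (rule tree_maximal_superlevel_le[OF assms(1-3) c])
      fix A assume A: "A \<in> sets M" "c * measure M A \<le> (\<integral>x\<in>A. \<bar>\<phi> x\<bar> \<partial>M)"
      show "measure M A \<le> (?K / c) powr p"
      proof (cases "measure M A = 0")
        case False
        then have mA: "0 < measure M A" by (simp add: zero_less_measure_iff)
        have "c * measure M A \<le> ?K * measure M A powr (1 - 1/p)"
          using A(2) weak_Lp_set_integral_le[OF assms(1,3,5,6) weak A(1)] by linarith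
        also have "\<dots> = ?K * measure M A / measure M A powr (1/p)"
          using mA by (simp add: powr_diff)
        finally have "measure M A powr (1/p) \<le> ?K / c"
          \<comment> \<open>The factor \<open>measure M A powr (1/p) / (c * measure M A)\<close>
            cancels the measure on both sides and leaves the claimed root estimate.\<close>
          using mult_right_mono[of "c * measure M A" "?K * measure M A / measure M A powr (1/p)"
              "measure M A powr (1/p) / (c * measure M A)"] mA c by (simp add: mult.assoc)
        then have "(measure M A powr (1/p)) powr p \<le> (?K / c) powr p"
          using assms(5) by (intro powr_mono2) auto
        then show ?thesis using mA assms(5) by (simp add: powr_powr)
      qed simp
    qed
    then have "measure M ?E powr (1/p) \<le> ((?K / c) powr p) powr (1/p)"
      using assms(5) by (intro powr_mono2) auto
    also have "\<dots> = ?K / c" using K c assms(5,6) by (simp add: powr_powr)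
    finally have "measure M ?E powr (1/p) * c \<le> ?K" using c by (simp only: pos_le_divide_eq)
    then show "c \<le> ?K / measure M ?E powr (1/p)" using pos by (simp only: pos_le_divide_eq powr_gt_zero mult.commute)
  qed
  then show ?thesis using pos by (simp only: pos_le_divide_eq powr_gt_zero)
qed (use assms in simp)

section \<open>Uniform variables\<close>

text \<open>The tail after the leading digit is at most \<open>(3/2) / 3 = 1/2\<close> in absolute
  value and cannot cancel a digit of absolute value \<open>1\<close>; shifting the sequence gives
  the induction. Applied to differences of sequences with digits \<open>0\<close> and
  \<open>1\<close>, this shows that base 3 determines the digits.\<close>

lemma ternary_expansion_zero:
  fixes d :: "nat \<Rightarrow> real"
  assumes d: "\<And>n. d n \<in> {-1, 0, 1}" and s: "(\<Sum>n. d n * (1/3) ^ n) = 0"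
  shows "d n = 0"
  using d s
proof (induction n arbitrary: d)
  have geo: "(\<lambda>n. (1/3) ^ n) sums (3/2 :: real)" using geometric_sums[of "1/3::real"] by simp
  have head: "d 0 = 0 \<and> (\<Sum>n. d (Suc n) * (1/3) ^ n) = 0"
    if d: "\<And>n. d n \<in> {-1, 0, 1}" and s: "(\<Sum>n. d n * (1/3) ^ n) = 0" for d :: "nat \<Rightarrow> real"
  proof -
    have ab: "\<bar>d n * (1/3) ^ n\<bar> \<le> (1/3) ^ n" "\<bar>d (Suc n) * (1/3) ^ n\<bar> \<le> (1/3) ^ n" for n
      using d[of n] d[of "Suc n"] by auto
    have sum: "summable (\<lambda>n. d n * (1/3) ^ n)"
      using ab by (intro summable_comparison_test'[OF sums_summable[OF geo], of 0]) auto
    have sum1: "summable (\<lambda>n. \<bar>d (Suc n) * (1/3) ^ n\<bar>)"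
      using ab by (intro summable_comparison_test'[OF sums_summable[OF geo], of 0]) auto
    let ?r = "\<Sum>n. d (Suc n) * (1/3) ^ n"
    have "(\<Sum>n. d (Suc n) * (1/3) ^ Suc n) = ?r / 3"
      using suminf_mult[OF summable_rabs_cancel[OF sum1], of "1/3"] by (simp add: mult.left_commute)
    then have eq: "d 0 + ?r / 3 = 0" using suminf_split_head[OF sum] s by simp
    have "\<bar>?r\<bar> \<le> (\<Sum>n. \<bar>d (Suc n) * (1/3) ^ n\<bar>)" using sum1 by (rule summable_rabs)
    also have "\<dots> \<le> (\<Sum>n. (1/3) ^ n)"
      using ab(2) by (intro suminf_le sum1 sums_summable[OF geo])
    also have "\<dots> = 3/2" using geo by (simp add: sums_iff)
    finally show ?thesis using eq d[of 0] by auto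
  qed
  {
    case 0
    then show ?case using head by blast
  next
    case (Suc n)
    then show ?case using head[of d] Suc.IH[of "\<lambda>n. d (Suc n)"] by blast
  }
qed

text \<open>The ternary digits of \<open>W x\<close> record which elements of the tree contain \<open>x\<close>, so a fibre of \<open>W\<close>
  lies in a single element of every level.\<close>

lemma tree_imp_atomless_variable:
  assumes "finite_measure M" "is_tree M T C"
  obtains W :: "'a \<Rightarrow> real" where "W \<in> borel_measurable M" "\<And>x. 0 \<le> W x \<and> W x \<le> 2"
    "\<And>w. measure M {x\<in>space M. W x = w} = 0"
proof -
  interpret finite_measure M by fact
  note tree = assms(2) and X = is_tree_space[OF assms(2)]
  \<comment> \<open>Only surjectivity onto \<open>T\<close> matters; an element listed twice would
    merely repeat a digit.\<close>
  define e where "e = from_nat_into T"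
  have range_e: "range e = T"
    using countable_tree[OF tree] X unfolding e_def by (intro range_from_nat_into) auto
  then have e: "e n \<in> sets M" for n using is_tree_sets[OF tree] by blast
  define W where "W x = (\<Sum>n. indicator (e n) x * (1/3) ^ n :: real)" for x
  have geo: "(\<lambda>n. (1/3) ^ n) sums (3/2 :: real)" using geometric_sums[of "1/3::real"] by simp
  have sum: "summable (\<lambda>n. indicator (e n) x * (1/3) ^ n :: real)" for x
    by (intro summable_comparison_test'[OF sums_summable[OF geo], of 0]) (auto simp: indicator_def)
  have meas: "W \<in> borel_measurable M"
    unfolding W_def using e by (intro borel_measurable_suminf) auto
  have bd: "0 \<le> W x \<and> W x \<le> 2" for x
  proof -
    have "W x \<le> (\<Sum>n. (1/3) ^ n)"
      unfolding W_def by (intro suminf_le sum sums_summable[OF geo]) (auto simp: indicator_def)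
    then show ?thesis using suminf_nonneg[OF sum[of x]] geo by (auto simp: W_def sums_iff)
  qed
  have same: "x \<in> I \<longleftrightarrow> y \<in> I" if xy: "W x = W y" and I: "I \<in> T" for x y I
  proof -
    obtain n where n: "I = e n" using I range_e by blast
    have "(\<Sum>n. (indicator (e n) x - indicator (e n) y) * (1/3) ^ n :: real) = 0"
      using suminf_diff[OF sum[of x] sum[of y]] xy by (simp add: W_def left_diff_distrib)
    then have "indicator (e n) x - indicator (e n) y = (0::real)"
      by (rule ternary_expansion_zero[rotated]) (auto simp: indicator_def)
    then show ?thesis using n by (auto simp: indicator_def split: if_splits)
  qed
  have "measure M {x\<in>space M. W x = w} = 0" for w
  proof (rule ccontr)
    assume "measure M {x\<in>space M. W x = w} \<noteq> 0"
    then have pos: "0 < measure M {x\<in>space M. W x = w}" (is "0 < measure M ?A")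
      by (simp add: zero_less_measure_iff)
    then obtain m where m: "\<And>J. J \<in> tree_level C (space M) m \<Longrightarrow> measure M J < measure M ?A"
      using tree_level_measure_less[OF tree] by blast
    have "?A \<noteq> {}"
    proof
      assume "?A = {}"
      then show False using pos by (simp only: measure_empty less_irrefl)
    qed
    then obtain x where x: "x \<in> ?A" by blast
    then have "x \<in> \<Union>(tree_level C (space M) m)" using Union_tree_level[OF tree X] by auto
    then obtain J where J: "J \<in> tree_level C (space M) m" "x \<in> J" by blast
    then have JT: "J \<in> T" using tree_level_subset[OF tree X] by blast
    have "?A \<subseteq> J"
    proof
      fix y assume "y \<in> ?A"
      then show "y \<in> J" using same[OF _ JT, of x y] J(2) x by simp
    qed
    then have "measure M ?A \<le> measure M J"
      using is_tree_sets[OF tree JT] by (intro finite_measure_mono)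
    then show False using m[OF J(1)] by simp
  qed
  then show thesis using that meas bd by blast
qed

section \<open>Uniform distribution on a measurable set\<close>

text \<open>The restriction of \<open>M\<close> to \<open>A\<close> is written as a density, so that
  the underlying space remains that of \<open>M\<close>.\<close>

lemma emeasure_distr_density_indicator:
  assumes [measurable]: "U \<in> measurable M N" "A \<in> sets M" "B \<in> sets N"
  shows "emeasure (distr (density M (indicator A)) N U) B = emeasure M {x\<in>A. U x \<in> B}"
proof -
  have "emeasure (distr (density M (indicator A)) N U) B
      = emeasure (density M (indicator A)) (U -` B \<inter> space M)"
    by (subst emeasure_distr) simp_all
  also have "\<dots> = (\<integral>\<^sup>+x. indicator A x * indicator (U -` B \<inter> space M) x \<partial>M)"
    by (intro emeasure_density) simp_all
  also have "\<dots> = (\<integral>\<^sup>+x. indicator {x\<in>A. U x \<in> B} x \<partial>M)"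
    by (intro nn_integral_cong) (auto simp: indicator_def)
  also have "\<dots> = emeasure M {x\<in>A. U x \<in> B}"
  proof (intro nn_integral_indicator)
    have "{x\<in>A. U x \<in> B} = {x\<in>space M. x \<in> A \<and> U x \<in> B}"
      using sets.sets_into_space[OF assms(2)] by auto
    then show "{x\<in>A. U x \<in> B} \<in> sets M" by simp
  qed
  finally show ?thesis .
qed

text \<open>The probability integral transform: \<open>H\<close> is the distribution function of
  \<open>W\<close> under the restriction of \<open>M\<close> to \<open>A\<close>, and it is
  continuous because \<open>W\<close> has no atoms.\<close>

lemma measure_cdf_transform:
  fixes W :: "'a \<Rightarrow> real"
  assumes "finite_measure M" and W: "W \<in> borel_measurable M" "\<And>x. 0 \<le> W x \<and> W x \<le> 2"
    and atomless: "\<And>w. measure M {x\<in>space M. W x = w} = 0" and A: "A \<in> sets M"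
  obtains H :: "real \<Rightarrow> real" where "mono H" "\<And>w. 0 \<le> H w \<and> H w \<le> measure M A"
    "\<And>v. 0 \<le> v \<Longrightarrow> v \<le> measure M A \<Longrightarrow> measure M {x\<in>A. H (W x) \<le> v} = v"
proof -
  interpret finite_measure M by fact
  note [measurable] = W(1) A
  define N where "N = distr (density M (indicator A)) borel W"
  have AX: "A \<subseteq> space M" using sets.sets_into_space[OF A] .
  have emN: "emeasure N B = emeasure M {x\<in>A. W x \<in> B}" if "B \<in> sets borel" for B
    unfolding N_def using emeasure_distr_density_indicator[OF W(1) A that] .
  have meN: "measure N B = measure M {x\<in>A. W x \<in> B}" if "B \<in> sets borel" for B
    using emN[OF that] by (simp add: measure_def)
  have "finite_measure N"
  proof (rule finite_measureI)
    show "emeasure N (space N) \<noteq> \<infinity>"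
      using emN[of UNIV] by (simp add: N_def emeasure_eq_measure)
  qed
  then interpret N: finite_borel_measure N
    by (intro finite_borel_measure.intro finite_borel_measure_axioms.intro) (simp_all add: N_def)
  define H where "H = cdf N"
  have H: "H w = measure M {x\<in>A. W x \<le> w}" for w
    using meN[of "{..w}"] by (simp add: H_def cdf_def)
  have "measure N {w} = 0" for w
  proof -
    have "measure M {x\<in>A. W x = w} \<le> measure M {x\<in>space M. W x = w}"
      using AX by (intro finite_measure_mono) auto
    then have "measure M {x\<in>A. W x = w} = 0" using atomless[of w] by (simp add: measure_le_0_iff)
    then show ?thesis using meN[of "{w}"] by simp
  qed
  then have cont: "isCont H w" for w unfolding H_def N.isCont_cdf .
  have mono: "mono H"
    unfolding H_def by (intro monoI N.cdf_nondecreasing)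
  \<comment> \<open>The points \<open>-1\<close> and \<open>2\<close> bracket the values of
    \<open>W\<close>, so \<open>H\<close> runs from \<open>0\<close> to \<open>measure M A\<close>
    between them.\<close>
  have H0: "H (-1) = 0"
  proof -
    have "\<not> W x \<le> -1" for x using W(2)[of x] by linarith
    then have "{x\<in>A. W x \<le> -1} = {}" by blast
    then show ?thesis by (simp only: H measure_empty)
  qed
  have H2: "H 2 = measure M A"
  proof -
    have "{x\<in>A. W x \<le> 2} = A" using W(2) by auto
    then show ?thesis by (simp add: H)
  qed
  have bd: "0 \<le> H w \<and> H w \<le> measure M A" for w
    using A by (auto simp: H intro!: finite_measure_mono)
  have "measure M {x\<in>A. H (W x) \<le> v} = v" if v: "0 \<le> v" "v \<le> measure M A" for v
  proof -
    \<comment> \<open>\<open>H\<close> may be constant on intervals. The largest point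
      \<open>w\<close> of this compact level set makes \<open>H (W x) \<le> v\<close> equivalent to
      \<open>W x \<le> w\<close>, because a larger value of \<open>W\<close> satisfying the first
      condition would again belong to the level set.\<close>
    let ?S = "{-1..2} \<inter> H -` {v}"
    have cS: "compact ?S"
    proof -
      have "closed ({-1..2} \<inter> H -` {v})"
        using cont by (intro continuous_closed_preimage) (auto intro: continuous_at_imp_continuous_on)
      then show ?thesis by (metis compact_Icc compact_Int_closed inf.left_idem)
    qed
    moreover have "?S \<noteq> {}"
    proof -
      obtain w where "-1 \<le> w" "w \<le> 2" "H w = v"
        using IVT[of H "-1" v 2] H0 H2 v cont by auto
      then show ?thesis by auto
    qed
    ultimately obtain w where w: "w \<in> ?S" "\<And>u. u \<in> ?S \<Longrightarrow> u \<le> w"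
      using compact_attains_sup[of ?S] by blast
    have "H (W x) \<le> v \<longleftrightarrow> W x \<le> w" for x
    proof
      assume le: "H (W x) \<le> v"
      show "W x \<le> w"
      proof (rule ccontr)
        assume "\<not> W x \<le> w"
        then have "H w \<le> H (W x)" using mono by (auto simp: mono_def)
        then have "W x \<in> ?S" using le w(1) W(2)[of x] by auto
        then show False using w(2) \<open>\<not> W x \<le> w\<close> by blast
      qed
    next
      assume "W x \<le> w"
      then show "H (W x) \<le> v" using mono w(1) by (auto simp: mono_def)
    qed
    then show ?thesis using H[of w] w(1) by simp
  qed
  then show thesis using that mono bd by blast
qed

text \<open>An affine change of the transformed variable carries \<open>[0, measure M A]\<close> to
  \<open>[a, b]\<close> and produces the constant density \<open>r\<close>.\<close>

lemma uniform_variable_on: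
  fixes W :: "'a \<Rightarrow> real"
  assumes "finite_measure M" and W: "W \<in> borel_measurable M" "\<And>x. 0 \<le> W x \<and> W x \<le> 2"
    and atomless: "\<And>w. measure M {x\<in>space M. W x = w} = 0" and A: "A \<in> sets M"
    and r: "0 \<le> r" "a \<le> b" "measure M A = r * (b - a)"
  obtains U :: "'a \<Rightarrow> real" where "U \<in> borel_measurable M"
    "\<And>h :: real \<Rightarrow> ennreal. h \<in> borel_measurable borel \<Longrightarrow>
      (\<integral>\<^sup>+x\<in>A. h (U x) \<partial>M) = ennreal r * (\<integral>\<^sup>+t\<in>{a..b}. h t \<partial>lborel)"
proof (cases "measure M A = 0")
  \<comment> \<open>Here \<open>r = 0\<close> or \<open>a = b\<close>, so both sides vanish; the
    rescaling below divides by \<open>r\<close>.\<close>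
  case True
  have null: "A \<in> null_sets M"
    using True A assms(1) by (intro null_setsI) (auto simp: finite_measure.emeasure_eq_measure)
  have "(\<integral>\<^sup>+x\<in>A. h (W x) \<partial>M) = ennreal r * (\<integral>\<^sup>+t\<in>{a..b}. h t \<partial>lborel)" for h :: "real \<Rightarrow> ennreal"
  proof -
    have "(\<integral>\<^sup>+x\<in>A. h (W x) \<partial>M) = 0" using null by (rule nn_integral_null_set)
    moreover have "ennreal r * (\<integral>\<^sup>+t\<in>{a..b}. h t \<partial>lborel) = 0"
    proof (cases "r = 0")
      case False
      then have "{a..b} \<in> null_sets lborel" using True r by auto
      then show ?thesis by (subst nn_integral_null_set) auto
    qed simp
    ultimately show ?thesis by simp
  qed
  then show thesis using that W(1) by blast
next
  case False
  interpret finite_measure M by fact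
  note [measurable] = W(1) A
  have "r \<noteq> 0" "a \<noteq> b" using False r by auto
  then have r: "0 < r" "a < b" "measure M A = r * (b - a)" using r by auto
  obtain H where H: "mono H" "\<And>w. 0 \<le> H w \<and> H w \<le> measure M A"
    "\<And>v. 0 \<le> v \<Longrightarrow> v \<le> measure M A \<Longrightarrow> measure M {x\<in>A. H (W x) \<le> v} = v"
    using measure_cdf_transform[OF assms(1) W atomless A] by blast
  define U where "U x = a + H (W x) / r" for x
  have [measurable]: "H \<in> borel_measurable borel" using H(1) by (rule borel_measurable_mono)
  have U[measurable]: "U \<in> borel_measurable M" unfolding U_def by measurable
  have AX: "A \<subseteq> space M" using sets.sets_into_space[OF A] .
  have Aset: "{x\<in>A. Q x} = {x\<in>space M. x \<in> A \<and> Q x}" for Q using AX by auto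
  have U': "U \<in> measurable (density M (indicator A)) borel" by simp
  have em: "emeasure (distr (density M (indicator A)) borel U) {u<..} = emeasure M {x\<in>A. u < U x}" for u
    using emeasure_distr_density_indicator[OF U A, of "{u<..}"] by simp
  \<comment> \<open>The term \<open>max a (min u b)\<close> clamps \<open>u\<close> to
    \<open>[a, b]\<close>, so one formula covers all positions of \<open>u\<close>.\<close>
  have em': "emeasure (density lborel (\<lambda>t. ennreal r * indicator {a..b} t)) {u<..}
      = ennreal (r * (b - max a (min u b)))" for u
  proof -
    have "emeasure (density lborel (\<lambda>t. ennreal r * indicator {a..b} t)) {u<..}
        = (\<integral>\<^sup>+t. ennreal r * indicator ({a..b} \<inter> {u<..}) t \<partial>lborel)"
      by (subst emeasure_density) (auto intro!: nn_integral_cong simp: indicator_def)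
    also have "\<dots> = ennreal r * emeasure lborel ({a..b} \<inter> {u<..})"
      by (intro nn_integral_cmult_indicator) simp
    also have "emeasure lborel ({a..b} \<inter> {u<..}) = ennreal (b - max a (min u b))"
    proof -
      consider "u < a" | "a \<le> u" "u \<le> b" | "b < u" by linarith
      then show ?thesis
      proof cases
        case 1
        then have "{a..b} \<inter> {u<..} = {a..b}" by auto
        then show ?thesis using 1 r by simp
      next
        case 2
        then have "{a..b} \<inter> {u<..} = {u<..b}" by auto
        then show ?thesis using 2 by (simp add: max_def min_def)
      next
        case 3
        then have "{a..b} \<inter> {u<..} = {}" by auto
        then show ?thesis using 3 r by simp
      qed
    qed
    finally show ?thesis using r by (simp add: ennreal_mult')
  qed
  have eq: "measure M {x\<in>A. u < U x} = r * (b - max a (min u b))" for u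
  proof -
    consider "u < a" | "a \<le> u" "u \<le> b" | "b < u" by linarith
    then show ?thesis
    proof cases
      case 1
      have "u < U x" for x
      proof -
        have "0 \<le> H (W x) / r" using H(2)[of "W x"] r by simp
        then show ?thesis using 1 by (simp add: U_def)
      qed
      then show ?thesis using 1 r by simp
    next
      case 2
      let ?v = "r * (u - a)"
      have "u < U x \<longleftrightarrow> \<not> H (W x) \<le> ?v" for x using r by (auto simp: U_def field_simps)
      then have "{x\<in>A. u < U x} = A - {x\<in>A. H (W x) \<le> ?v}" by auto
      then have "measure M {x\<in>A. u < U x} = measure M A - measure M {x\<in>A. H (W x) \<le> ?v}"
        by (simp only:) (intro finite_measure_Diff, auto simp: Aset)
      also have "\<dots> = r * (b - a) - ?v"
        using H(3)[of ?v] 2 r by (simp add: mult_left_mono)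
      finally show ?thesis using 2 by (simp add: max_def min_def algebra_simps)
    next
      case 3
      have "\<not> u < U x" for x
      proof -
        have "H (W x) / r \<le> b - a" using H(2)[of "W x"] r by (simp add: field_simps)
        then show ?thesis using 3 by (simp add: U_def)
      qed
      then show ?thesis using 3 r by simp
    qed
  qed
  \<comment> \<open>Both laws have finite upper tails, and agreement on these tails determines a
    Borel measure on the line.\<close>
  have dist: "distr (density M (indicator A)) borel U = density lborel (\<lambda>t. ennreal r * indicator {a..b} t)"
    by (intro measure_eqI_lessThan) (simp_all add: em em' eq emeasure_eq_measure)
  have "(\<integral>\<^sup>+x\<in>A. h (U x) \<partial>M) = ennreal r * (\<integral>\<^sup>+t\<in>{a..b}. h t \<partial>lborel)"
    if [measurable]: "h \<in> borel_measurable borel" for h :: "real \<Rightarrow> ennreal"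
  proof -
    have "(\<integral>\<^sup>+x\<in>A. h (U x) \<partial>M) = (\<integral>\<^sup>+x. h (U x) \<partial>density M (indicator A))"
      by (subst nn_integral_density) (auto simp: mult.commute)
    also have "\<dots> = (\<integral>\<^sup>+t. h t \<partial>density lborel (\<lambda>t. ennreal r * indicator {a..b} t))"
      unfolding dist[symmetric] by (subst nn_integral_distr[OF U']) simp_all
    also have "\<dots> = (\<integral>\<^sup>+t. ennreal r * (h t * indicator {a..b} t) \<partial>lborel)"
      by (subst nn_integral_density) (auto simp: ac_simps)
    finally show ?thesis by (subst (asm) nn_integral_cmult) simp_all
  qed
  then show thesis using that U by blast
qed

section \<open>Unions of elements of one level\<close>

text \<open>Elements are dropped until the total first falls below \<open>c\<close>; the last one
  dropped weighs less than \<open>\<delta>\<close>, so the total misses \<open>c\<close> by less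
  than that.\<close>

lemma subset_sum_near:
  fixes w :: "'b \<Rightarrow> real"
  assumes "finite S" "\<And>i. i \<in> S \<Longrightarrow> w i < \<delta>" "0 < \<delta>" "0 \<le> c" "c \<le> sum w S"
  shows "\<exists>G\<subseteq>S. c - \<delta> < sum w G \<and> sum w G \<le> c"
  using assms
proof (induction S)
  case (insert x S)
  show ?case
  proof (cases "c \<le> sum w S")
    case True
    then show ?thesis using insert by (metis insertCI subset_insertI2)
  next
    case False
    then have "c - \<delta> < sum w S \<and> sum w S \<le> c" using insert.prems(1)[of x] insert.prems(4) insert.hyps by simp
    then show ?thesis by (intro exI[of _ S]) auto
  qed
qed auto

lemma tree_level_AE_disjoint:
  assumes "finite_measure M" "is_tree M T C" "J \<in> tree_level C (space M) m"
    "K \<in> tree_level C (space M) m" "J \<noteq> K"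
  shows "AE x in M. \<not> (x \<in> J \<and> x \<in> K)"
proof -
  have T: "J \<in> T" "K \<in> T"
    using assms(3,4) tree_level_subset[OF assms(2) is_tree_space[OF assms(2)]] by auto
  have "J \<inter> K \<in> null_sets M"
    using tree_level_null[OF assms] T is_tree_sets[OF assms(2)] assms(1)
    by (intro null_setsI) (auto simp: finite_measure.emeasure_eq_measure)
  then show ?thesis by (intro AE_I'[of "J \<inter> K"]) auto
qed

lemma measure_Union_level:
  assumes "finite_measure M" "is_tree M T C" "G \<subseteq> tree_level C (space M) m"
  shows "measure M (\<Union>G) = (\<Sum>J\<in>G. measure M J)"
proof (intro measure_Union_AE)
  show "finite G"
    using finite_subset[OF assms(3) finite_tree_level[OF assms(2) is_tree_space[OF assms(2)]]] .
  show "J \<in> fmeasurable M" if "J \<in> G" for J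
  proof -
    have "J \<in> T" using that assms(3) tree_level_subset[OF assms(2) is_tree_space[OF assms(2)]] by blast
    then show ?thesis
      using is_tree_sets[OF assms(2)] finite_measure.fmeasurable_eq_sets[OF assms(1)] by blast
  qed
  show "pairwise (\<lambda>J K. AE x in M. x \<notin> J \<or> x \<notin> K) G"
    using tree_level_AE_disjoint[OF assms(1,2)] assms(3) by (auto simp: pairwise_def subset_iff)
qed

text \<open>Each \<open>J\<close> in \<open>G\<close> receives its own variable spread over
  \<open>[0, s]\<close> with density \<open>measure M J / s\<close>, and the complement of the union
  one spread over \<open>[s, 1]\<close>. The densities on \<open>[0, s]\<close> add up to
  \<open>1\<close>, so the glued variable is uniform on \<open>[0, 1]\<close>, while a function of
  it has the same average on every \<open>J\<close>.\<close>

lemma level_adapted_uniform: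
  assumes "prob_space M" "is_tree M T C" and G: "G \<subseteq> tree_level C (space M) m"
    and s: "s = measure M (\<Union>G)" "0 < s"
  obtains V :: "'a \<Rightarrow> real" where "V \<in> borel_measurable M"
    "\<And>(h :: real \<Rightarrow> ennreal) J. h \<in> borel_measurable borel \<Longrightarrow> J \<in> G \<Longrightarrow>
      (\<integral>\<^sup>+x\<in>J. h (V x) \<partial>M) = ennreal (measure M J / s) * (\<integral>\<^sup>+t\<in>{0..s}. h t \<partial>lborel)"
    "\<And>h :: real \<Rightarrow> ennreal. h \<in> borel_measurable borel \<Longrightarrow>
      (\<integral>\<^sup>+x. h (V x) \<partial>M) = (\<integral>\<^sup>+t\<in>{0..1}. h t \<partial>lborel)"
proof -
  interpret prob_space M by fact
  note tree = assms(2) and X = is_tree_space[OF assms(2)]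
  obtain W :: "'a \<Rightarrow> real" where W: "W \<in> borel_measurable M" "\<And>x. 0 \<le> W x \<and> W x \<le> 2"
    "\<And>w. measure M {x\<in>space M. W x = w} = 0"
    using tree_imp_atomless_variable[OF finite_measure_axioms tree] by blast
  note uniform = uniform_variable_on[OF finite_measure_axioms W]
  have finG: "finite G" using finite_subset[OF G finite_tree_level[OF tree X]] .
  have GM: "J \<in> sets M" if "J \<in> G" for J
    using that G tree_level_subset[OF tree X] is_tree_sets[OF tree] by blast
  let ?A = "\<Union>G"
  have A: "?A \<in> sets M" using finG GM by (intro sets.finite_Union) auto
  have "\<exists>U. U \<in> borel_measurable M \<and> (\<forall>h :: real \<Rightarrow> ennreal. h \<in> borel_measurable borel \<longrightarrow>
      (\<integral>\<^sup>+x\<in>J. h (U x) \<partial>M) = ennreal (measure M J / s) * (\<integral>\<^sup>+t\<in>{0..s}. h t \<partial>lborel))"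
    if J: "J \<in> G" for J
    by (rule uniform[OF GM[OF J], of "measure M J / s" 0 s]) (use s in auto)
  then obtain U where U: "\<And>J. J \<in> G \<Longrightarrow> U J \<in> borel_measurable M"
    "\<And>J (h :: real \<Rightarrow> ennreal). J \<in> G \<Longrightarrow> h \<in> borel_measurable borel \<Longrightarrow>
      (\<integral>\<^sup>+x\<in>J. h (U J x) \<partial>M) = ennreal (measure M J / s) * (\<integral>\<^sup>+t\<in>{0..s}. h t \<partial>lborel)"
    by metis
  \<comment> \<open>The factor \<open>1\<close> is the density passed to \<open>uniform\<close>. If
    \<open>s = 1\<close>, the complement is null and the degenerate case of that lemma
    applies.\<close>
  have compl: "measure M (space M - ?A) = 1 * (1 - s)" and s1: "s \<le> 1"
    using prob_compl[OF A] s by auto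
  obtain U' where U': "U' \<in> borel_measurable M"
    "\<And>h :: real \<Rightarrow> ennreal. h \<in> borel_measurable borel \<Longrightarrow>
      (\<integral>\<^sup>+x\<in>space M - ?A. h (U' x) \<partial>M) = ennreal 1 * (\<integral>\<^sup>+t\<in>{s..1}. h t \<partial>lborel)"
    using uniform[OF sets.compl_sets[OF A] zero_le_one s1 compl] by blast
  \<comment> \<open>Off the null overlaps exactly one summand survives on the union, so the sum
    selects \<open>U J x\<close>.\<close>
  define V where "V x = (if x \<in> ?A then \<Sum>J\<in>G. indicator J x * U J x else U' x)" for x
  have V: "V \<in> borel_measurable M"
    unfolding V_def using A GM U(1) U'(1)
    by (intro measurable_If_set borel_measurable_sum borel_measurable_times borel_measurable_indicator) auto
  have AE: "AE x in M. \<forall>J\<in>G. \<forall>K\<in>G. J \<noteq> K \<longrightarrow> \<not> (x \<in> J \<and> x \<in> K)"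
  proof (intro AE_finite_allI finG)
    fix J K assume "J \<in> G" "K \<in> G"
    then show "AE x in M. J \<noteq> K \<longrightarrow> \<not> (x \<in> J \<and> x \<in> K)"
      using G tree_level_AE_disjoint[OF finite_measure_axioms tree, of J m K] by (cases "J = K") auto
  qed
  have VJ: "(\<integral>\<^sup>+x\<in>J. h (V x) \<partial>M) = ennreal (measure M J / s) * (\<integral>\<^sup>+t\<in>{0..s}. h t \<partial>lborel)"
    if h: "h \<in> borel_measurable borel" and J: "J \<in> G" for h :: "real \<Rightarrow> ennreal" and J
  proof -
    have "(\<integral>\<^sup>+x\<in>J. h (V x) \<partial>M) = (\<integral>\<^sup>+x\<in>J. h (U J x) \<partial>M)"
    proof (intro nn_integral_cong_AE)
      show "AE x in M. h (V x) * indicator J x = h (U J x) * indicator J x"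
        using AE
      proof eventually_elim
        case (elim x)
        show ?case
        proof (cases "x \<in> J")
          case True
          have "(\<Sum>K\<in>G. indicator K x * U K x) = (\<Sum>K\<in>G. if K = J then U J x else 0)"
            using elim True J by (intro sum.cong) (auto simp: indicator_def)
          also have "\<dots> = U J x" using J finG by simp
          finally have "V x = U J x" using True J by (auto simp: V_def)
          then show ?thesis by simp
        qed simp
      qed
    qed
    then show ?thesis using U(2)[OF J h] by simp
  qed
  have "(\<integral>\<^sup>+x. h (V x) \<partial>M) = (\<integral>\<^sup>+t\<in>{0..1}. h t \<partial>lborel)"
    if h[measurable]: "h \<in> borel_measurable borel" for h :: "real \<Rightarrow> ennreal"
  proof -
    note [measurable] = V A
    have AE_sum: "AE x in M. indicator (\<Union>J\<in>G. J) x = (\<Sum>J\<in>G. indicator J x :: ennreal)"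
      using G tree_level_AE_disjoint[OF finite_measure_axioms tree]
      by (intro AE_indicator_UN_eq_sum[OF finG]) blast
    have "(\<integral>\<^sup>+x\<in>?A. h (V x) \<partial>M) = (\<integral>\<^sup>+x. (\<Sum>J\<in>G. h (V x) * indicator J x) \<partial>M)"
    proof (intro nn_integral_cong_AE)
      show "AE x in M. h (V x) * indicator ?A x = (\<Sum>J\<in>G. h (V x) * indicator J x)"
        using AE_sum by eventually_elim (simp add: sum_distrib_left)
    qed
    also have "\<dots> = (\<Sum>J\<in>G. \<integral>\<^sup>+x\<in>J. h (V x) \<partial>M)"
      using GM V
      by (intro nn_integral_sum borel_measurable_times_ennreal borel_measurable_indicator
          measurable_compose[OF V h])
    also have "\<dots> = (\<Sum>J\<in>G. ennreal (measure M J / s)) * (\<integral>\<^sup>+t\<in>{0..s}. h t \<partial>lborel)"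
      by (simp add: VJ[OF h] sum_distrib_right)
    also have "(\<Sum>J\<in>G. ennreal (measure M J / s)) = 1"
      using s measure_Union_level[OF finite_measure_axioms tree G]
      by (subst sum_ennreal) (auto simp: sum_divide_distrib[symmetric])
    finally have 1: "(\<integral>\<^sup>+x\<in>?A. h (V x) \<partial>M) = (\<integral>\<^sup>+t\<in>{0..s}. h t \<partial>lborel)" by simp
    have "(\<integral>\<^sup>+x\<in>space M - ?A. h (V x) \<partial>M) = (\<integral>\<^sup>+x\<in>space M - ?A. h (U' x) \<partial>M)"
      by (intro nn_integral_cong) (auto simp: V_def indicator_def)
    then have 2: "(\<integral>\<^sup>+x\<in>space M - ?A. h (V x) \<partial>M) = (\<integral>\<^sup>+t\<in>{s..1}. h t \<partial>lborel)"
      using U'(2)[OF h] by simp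
    have "(\<integral>\<^sup>+x. h (V x) \<partial>M) = (\<integral>\<^sup>+x. h (V x) * indicator ?A x + h (V x) * indicator (space M - ?A) x \<partial>M)"
      by (intro nn_integral_cong) (auto simp: indicator_def)
    also have "\<dots> = (\<integral>\<^sup>+t\<in>{0..s}. h t \<partial>lborel) + (\<integral>\<^sup>+t\<in>{s..1}. h t \<partial>lborel)"
      unfolding 1[symmetric] 2[symmetric] by (intro nn_integral_add) measurable
    also have "\<dots> = (\<integral>\<^sup>+t. h t * indicator {0..s} t + h t * indicator {s..1} t \<partial>lborel)"
      by (intro nn_integral_add[symmetric]) measurable
    also have "\<dots> = (\<integral>\<^sup>+t\<in>{0..1}. h t \<partial>lborel)"
    proof (intro nn_integral_cong_AE)
      \<comment> \<open>Both closed intervals contain \<open>s\<close>, so the integrands agree only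
        away from this point.\<close>
      have "AE t in lborel. t \<noteq> s" by (rule AE_lborel_singleton)
      then show "AE t in lborel. h t * indicator {0..s} t + h t * indicator {s..1} t = h t * indicator {0..1} t"
      proof eventually_elim
        case (elim t)
        then show ?case using s(2) s1 by (auto simp: indicator_def)
      qed
    qed
    finally show ?thesis .
  qed
  then show thesis using that V VJ by blast
qed

section \<open>Extremal functions\<close>

text \<open>Without the cut-off this is the decreasing function whose distribution function is
  exactly \<open>(F / t) powr p\<close>, the extreme case of weak norm \<open>F\<close>. Truncation
  at \<open>\<sigma>\<close> adjusts the integral. At the singularity the value is \<open>0\<close>,
  because \<open>0 powr (-1/p) = 0\<close>.\<close>

definition power_profile :: "real \<Rightarrow> real \<Rightarrow> real \<Rightarrow> real \<Rightarrow> real" where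
  "power_profile p F \<sigma> t = F * t powr (-1/p) * indicator {0..\<sigma>} t"

lemma power_profile_measurable [measurable]: "power_profile p F \<sigma> \<in> borel_measurable borel"
  unfolding power_profile_def by measurable

lemma power_profile_nonneg: "0 \<le> F \<Longrightarrow> 0 \<le> power_profile p F \<sigma> t"
  by (simp add: power_profile_def)

lemma nn_integral_power_profile:
  assumes "1 < p" "0 \<le> F" "0 \<le> \<sigma>" "0 \<le> u"
  shows "(\<integral>\<^sup>+t\<in>{0..u}. ennreal (power_profile p F \<sigma> t) \<partial>lborel)
    = ennreal (p / (p - 1) * F * min u \<sigma> powr (1 - 1/p))"
proof -
  let ?v = "min u \<sigma>"
  have "((\<lambda>t. F * t powr (-1/p)) has_integral F * (?v powr (-1/p + 1) / (-1/p + 1))) {0..?v}"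
    using assms by (intro has_integral_mult_right has_integral_powr_from_0) (auto simp: field_simps)
  also have "F * (?v powr (-1/p + 1) / (-1/p + 1)) = p / (p - 1) * F * ?v powr (1 - 1/p)"
  proof -
    have e: "-1/p + 1 = 1 - 1/p" by simp
    have c: "1 - 1/p = (p - 1) / p" using assms(1) by (simp add: field_simps)
    have "F * (x / (1 - 1/p)) = p / (p - 1) * F * x" for x
      unfolding c by simp
    then show ?thesis unfolding e .
  qed
  finally have "(\<integral>\<^sup>+t. ennreal (F * t powr (-1/p)) * indicator {0..?v} t \<partial>lborel)
      = ennreal (p / (p - 1) * F * ?v powr (1 - 1/p))"
    using assms(2) by (intro nn_integral_has_integral_lebesgue') auto
  also have "(\<integral>\<^sup>+t. ennreal (F * t powr (-1/p)) * indicator {0..?v} t \<partial>lborel)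
      = (\<integral>\<^sup>+t\<in>{0..u}. ennreal (power_profile p F \<sigma> t) \<partial>lborel)"
    by (intro nn_integral_cong) (auto simp: power_profile_def indicator_def)
  finally show ?thesis by simp
qed

lemma power_profile_gt_imp:
  assumes "0 < p" "0 < F" "0 < t" "t < power_profile p F \<sigma> u"
  shows "u \<in> {0..(F / t) powr p}"
proof -
  have "u \<in> {0..\<sigma>}" by (rule ccontr) (use assms(3,4) in \<open>simp add: power_profile_def\<close>)
  moreover have "u \<noteq> 0" using assms(3,4) by (auto simp: power_profile_def)
  ultimately have u: "0 < u" "t < F * u powr (-1/p)"
    using assms(4) by (auto simp: power_profile_def)
  have "t < F / u powr (1/p)" using u(2) by (simp add: powr_minus_divide)
  then have "t * u powr (1/p) < F" using u(1) by (simp only: pos_less_divide_eq powr_gt_zero)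
  then have "u powr (1/p) \<le> F / t" using assms(3) by (simp add: pos_le_divide_eq mult.commute)
  then have "(u powr (1/p)) powr p \<le> (F / t) powr p" using assms(1) by (intro powr_mono2) auto
  then show ?thesis using u assms(1) by (simp add: powr_powr)
qed

lemma power_profile_gt:
  assumes "0 < p" "0 < F" "0 < u" "u < \<sigma>"
  shows "F * \<sigma> powr (-1/p) < power_profile p F \<sigma> u"
  using assms by (auto simp: power_profile_def intro!: powr_less_mono2_neg)

text \<open>Truncation does not lower the norm: its value is already reached at the height of the
  profile at the cut-off point, whose superlevel set contains the whole interval
  \<open>(0, \<sigma>)\<close>.\<close>

lemma weak_Lp_norm_power_profile:
  assumes "prob_space M" "V \<in> borel_measurable M" "0 < p" "0 < F" "0 < \<sigma>" "\<sigma> \<le> 1"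
    and unif: "\<And>h :: real \<Rightarrow> ennreal. h \<in> borel_measurable borel \<Longrightarrow>
      (\<integral>\<^sup>+x. h (V x) \<partial>M) = (\<integral>\<^sup>+t\<in>{0..1}. h t \<partial>lborel)"
  shows "weak_Lp_norm M p (\<lambda>x. power_profile p F \<sigma> (V x)) = ereal F"
proof -
  interpret prob_space M by fact
  note [measurable] = assms(2)
  let ?g = "power_profile p F \<sigma>"
  have em: "emeasure M {x\<in>space M. t < ?g (V x)} = emeasure lborel ({0..1} \<inter> {u. t < ?g u})" for t
  proof -
    have "emeasure M {x\<in>space M. t < ?g (V x)} = (\<integral>\<^sup>+x. indicator {x\<in>space M. t < ?g (V x)} x \<partial>M)"
      by (intro nn_integral_indicator[symmetric]) measurable
    also have "\<dots> = (\<integral>\<^sup>+x. indicator {u. t < ?g u} (V x) \<partial>M)"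
      by (intro nn_integral_cong) (auto simp: indicator_def)
    also have "\<dots> = (\<integral>\<^sup>+u\<in>{0..1}. indicator {u. t < ?g u} u \<partial>lborel)"
      by (intro unif) measurable
    also have "\<dots> = (\<integral>\<^sup>+u. indicator ({0..1} \<inter> {u. t < ?g u}) u \<partial>lborel)"
      by (intro nn_integral_cong) (auto simp: indicator_def)
    also have "\<dots> = emeasure lborel ({0..1} \<inter> {u. t < ?g u})"
      by (intro nn_integral_indicator) measurable
    finally show ?thesis .
  qed
  have abs: "\<bar>?g u\<bar> = ?g u" for u using power_profile_nonneg[of F p \<sigma> u] assms(4) by simp
  have le: "t * measure M {x\<in>space M. t < \<bar>?g (V x)\<bar>} powr (1/p) \<le> F" if t: "0 < t" for t
  proof -
    have "ennreal (measure M {x\<in>space M. t < ?g (V x)}) \<le> emeasure lborel {0..(F / t) powr p}"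
      unfolding emeasure_eq_measure[symmetric] em using power_profile_gt_imp[OF assms(3,4) t]
      by (intro emeasure_mono) auto
    then have "measure M {x\<in>space M. t < ?g (V x)} \<le> (F / t) powr p" by simp
    then have "measure M {x\<in>space M. t < ?g (V x)} powr (1/p) \<le> ((F / t) powr p) powr (1/p)"
      using assms(3) by (intro powr_mono2) auto
    also have "\<dots> = F / t" using assms(3,4) t by (simp add: powr_powr)
    finally show ?thesis using t by (simp add: abs field_simps)
  qed
  \<comment> \<open>This is the height at the cut-off, chosen so that
    \<open>t * \<sigma> powr (1/p) = F\<close>.\<close>
  define t where "t = F * \<sigma> powr (-1/p)"
  have t: "0 < t" using assms by (simp add: t_def)
  have "ennreal \<sigma> = emeasure lborel {0<..<\<sigma>}" using assms(5) by simp
  also have "\<dots> \<le> ennreal (measure M {x\<in>space M. t < ?g (V x)})"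
    unfolding emeasure_eq_measure[symmetric] em
  proof (intro emeasure_mono)
    show "{0<..<\<sigma>} \<subseteq> {0..1} \<inter> {u. t < ?g u}"
      using power_profile_gt[OF assms(3,4)] assms(6) by (auto simp: t_def)
  qed measurable
  finally have "\<sigma> \<le> measure M {x\<in>space M. t < ?g (V x)}" by simp
  then have "t * \<sigma> powr (1/p) \<le> t * measure M {x\<in>space M. t < ?g (V x)} powr (1/p)"
    using t assms(3,5) by (intro mult_left_mono powr_mono2) auto
  moreover have "t * \<sigma> powr (1/p) = F"
    using assms(5) by (simp add: t_def powr_minus_divide)
  ultimately have ge: "F \<le> t * measure M {x\<in>space M. t < \<bar>?g (V x)\<bar>} powr (1/p)" by (simp add: abs)
  show ?thesis
  proof (rule antisym)
    show "weak_Lp_norm M p (\<lambda>x. ?g (V x)) \<le> ereal F"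
      unfolding weak_Lp_norm_def using le by (intro SUP_least) auto
    have "ereal F \<le> ereal (t * measure M {x\<in>space M. t < \<bar>?g (V x)\<bar>} powr (1/p))" using ge by simp
    also have "\<dots> \<le> weak_Lp_norm M p (\<lambda>x. ?g (V x))"
      unfolding weak_Lp_norm_def using t by (intro SUP_upper) auto
    finally show "ereal F \<le> weak_Lp_norm M p (\<lambda>x. ?g (V x))" .
  qed
qed

section \<open>The maximal function of the extremal candidate\<close>

text \<open>The index set of the supremum depends on \<open>x\<close>; weighting by indicators gives
  a fixed countable index set, and the added terms are \<open>0\<close>, the least element of
  \<open>ennreal\<close>.\<close>

lemma tree_maximal_measurable:
  assumes "is_tree M T C"
  shows "tree_maximal M T \<phi> \<in> borel_measurable M"
proof -
  define a where "a I = ennreal ((1 / measure M I) * (\<integral>y\<in>I. \<bar>\<phi> y\<bar> \<partial>M))" for I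
  have "tree_maximal M T \<phi> x = (SUP I\<in>T. a I * indicator I x)" for x
  proof (rule antisym)
    show "tree_maximal M T \<phi> x \<le> (SUP I\<in>T. a I * indicator I x)"
      unfolding tree_maximal_def a_def[symmetric] by (intro SUP_least) (auto intro!: SUP_upper2)
    show "(SUP I\<in>T. a I * indicator I x) \<le> tree_maximal M T \<phi> x"
      unfolding tree_maximal_def a_def[symmetric]
      by (intro SUP_least) (auto simp: indicator_def intro!: SUP_upper)
  qed
  moreover have "(\<lambda>x. SUP I\<in>T. a I * indicator I x) \<in> borel_measurable M"
    using countable_tree[OF assms] is_tree_sets[OF assms]
    by (intro borel_measurable_SUP borel_measurable_times borel_measurable_indicator) auto
  ultimately show ?thesis by (simp cong: measurable_cong)
qed

text \<open>Every \<open>J\<close> in \<open>G\<close> has the same average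
  \<open>?K * min s \<sigma> powr (1 - 1/p) / s\<close>, and the two bounds on \<open>s\<close> make
  it at least \<open>lam\<close>. Hence the union of \<open>G\<close> lies in the superlevel
  set.\<close>

lemma tree_maximal_extremal:
  fixes lam :: real
  assumes "prob_space M" "is_tree M T C" "1 < p" "0 < F" "0 < f" "f \<le> p / (p - 1) * F" "0 < lam"
    and G: "G \<subseteq> tree_level C (space M) m" and s: "s = measure M (\<Union>G)" "0 < s"
    and s_le: "s \<le> f / lam" "s \<le> (p / (p - 1) * F / lam) powr p"
  obtains \<phi> :: "'a \<Rightarrow> real" where "integrable M \<phi>" "\<And>x. 0 \<le> \<phi> x" "(\<integral>x. \<phi> x \<partial>M) = f"
    "weak_Lp_norm M p \<phi> = ereal F"
    "s \<le> measure M {x\<in>space M. tree_maximal M T \<phi> x \<ge> ennreal lam}"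
proof -
  interpret prob_space M by fact
  note tree = assms(2) and X = is_tree_space[OF assms(2)]
  let ?K = "p / (p - 1) * F"
  have K: "0 < ?K" using assms(3,4) by simp
  obtain V :: "'a \<Rightarrow> real" where V[measurable]: "V \<in> borel_measurable M" and
    VJ: "\<And>(h :: real \<Rightarrow> ennreal) J. h \<in> borel_measurable borel \<Longrightarrow> J \<in> G \<Longrightarrow>
      (\<integral>\<^sup>+x\<in>J. h (V x) \<partial>M) = ennreal (measure M J / s) * (\<integral>\<^sup>+t\<in>{0..s}. h t \<partial>lborel)" and
    V1: "\<And>h :: real \<Rightarrow> ennreal. h \<in> borel_measurable borel \<Longrightarrow>
      (\<integral>\<^sup>+x. h (V x) \<partial>M) = (\<integral>\<^sup>+t\<in>{0..1}. h t \<partial>lborel)"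
    using level_adapted_uniform[OF assms(1,2) G s] by blast
  \<comment> \<open>The solution of \<open>?K * \<sigma> powr (1 - 1/p) = f\<close>, which
    prescribes the integral; the bound \<open>\<sigma> \<le> 1\<close> comes from
    \<open>f \<le> ?K\<close>.\<close>
  define \<sigma> where "\<sigma> = (f / ?K) powr (p / (p - 1))"
  have fK: "0 < f / ?K" "f / ?K \<le> 1" using assms(5,6) K by (simp_all only: zero_less_divide_iff divide_le_eq_1_pos simp_thms)
  have \<sigma>: "0 < \<sigma>" "\<sigma> \<le> 1"
  proof -
    show "0 < \<sigma>" using fK unfolding \<sigma>_def by (simp only: powr_gt_zero)
    show "\<sigma> \<le> 1" unfolding \<sigma>_def by (rule powr_le1) (use fK assms(3) in auto)
  qed
  have e: "p / (p - 1) * (1 - 1/p) = 1" using assms(3) by (simp add: field_simps)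
  have "\<sigma> powr (1 - 1/p) = (f / ?K) powr 1" unfolding \<sigma>_def powr_powr e ..
  then have \<sigma>_pow: "\<sigma> powr (1 - 1/p) = f / ?K" using fK(1) by (simp only: powr_one less_imp_le)
  then have \<sigma>_f: "?K * \<sigma> powr (1 - 1/p) = f" using assms(3,4) by simp
  define \<phi> where "\<phi> x = power_profile p F \<sigma> (V x)" for x
  have \<phi>[measurable]: "\<phi> \<in> borel_measurable M" unfolding \<phi>_def by measurable
  have nonneg: "0 \<le> \<phi> x" for x unfolding \<phi>_def using assms(4) by (intro power_profile_nonneg) simp
  have "(\<integral>\<^sup>+x. ennreal (\<phi> x) \<partial>M) = ennreal f"
    unfolding \<phi>_def using assms(3,4) \<sigma>
    by (subst V1) (auto simp only: nn_integral_power_profile less_imp_le zero_le_one min.absorb2 \<sigma>_f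
        intro!: measurable_compose[OF power_profile_measurable measurable_ennreal])
  then have "has_bochner_integral M \<phi> f"
    using nonneg assms(5) by (intro has_bochner_integral_nn_integral) auto
  then have int: "integrable M \<phi>" "(\<integral>x. \<phi> x \<partial>M) = f"
    by (auto simp: has_bochner_integral_iff)
  have norm: "weak_Lp_norm M p \<phi> = ereal F"
    unfolding \<phi>_def using assms(1,3,4) \<sigma> V V1 by (intro weak_Lp_norm_power_profile) auto
  \<comment> \<open>If the cut-off lies beyond \<open>s\<close>, the weak norm bound on
    \<open>s\<close> applies. Otherwise all the mass \<open>f\<close> sits over
    \<open>[0, s]\<close> and the bound \<open>s \<le> f / lam\<close> applies.\<close>
  have lam_s: "lam * s \<le> ?K * min s \<sigma> powr (1 - 1/p)"
  proof (cases "s \<le> \<sigma>")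
    case True
    have "s powr (1/p) \<le> ((?K / lam) powr p) powr (1/p)"
      using s s_le(2) assms(3) by (intro powr_mono2) auto
    also have "\<dots> = ?K / lam" using assms(3,4,7) by (simp add: powr_powr)
    finally have "s powr (1/p) * lam \<le> ?K" using assms(7) by (simp only: pos_le_divide_eq)
    then have "s powr (1/p) * lam * s powr (1 - 1/p) \<le> ?K * s powr (1 - 1/p)"
      by (intro mult_right_mono) auto
    moreover have "s powr (1/p) * lam * s powr (1 - 1/p) = lam * s"
      using s(2) by (simp add: mult.commute[of _ lam] mult.assoc powr_add[symmetric])
    ultimately show ?thesis using True by (simp only: min.absorb1)
  next
    case False
    then show ?thesis using s_le(1) assms(7) \<sigma>_f by (simp add: field_simps)
  qed
  have avg: "lam \<le> 1 / measure M J * (\<integral>y\<in>J. \<bar>\<phi> y\<bar> \<partial>M)" if J: "J \<in> G" for J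
  proof -
    have JT: "J \<in> T" using J G tree_level_subset[OF tree X] by blast
    note JM[measurable] = is_tree_sets[OF tree JT] and Jpos = is_tree_pos[OF tree JT]
    have "ennreal (\<integral>y\<in>J. \<bar>\<phi> y\<bar> \<partial>M) = (\<integral>\<^sup>+x. ennreal (indicator J x *\<^sub>R \<bar>\<phi> x\<bar>) \<partial>M)"
      unfolding set_lebesgue_integral_def using int(1)
      by (intro nn_integral_eq_integral[symmetric] integrable_mult_indicator) auto
    also have "\<dots> = (\<integral>\<^sup>+x\<in>J. ennreal (\<phi> x) \<partial>M)"
      using nonneg by (intro nn_integral_cong) (auto simp: indicator_def)
    also have "\<dots> = ennreal (measure M J / s) * ennreal (?K * min s \<sigma> powr (1 - 1/p))"
      unfolding \<phi>_def using assms(3,4) \<sigma> s J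
      by (subst VJ) (auto simp only: nn_integral_power_profile less_imp_le
        intro!: measurable_compose[OF power_profile_measurable measurable_ennreal])
    also have "\<dots> = ennreal (measure M J / s * (?K * min s \<sigma> powr (1 - 1/p)))"
      using s(2) by (intro ennreal_mult'[symmetric]) auto
    finally have "(\<integral>y\<in>J. \<bar>\<phi> y\<bar> \<partial>M) = measure M J / s * (?K * min s \<sigma> powr (1 - 1/p))"
      using s(2) assms(3,4) by (subst (asm) ennreal_inj) (auto simp: set_lebesgue_integral_def intro!: integral_nonneg mult_nonneg_nonneg)
    also have "\<dots> \<ge> measure M J / s * (lam * s)"
      using lam_s s(2) by (intro mult_left_mono) auto
    finally show ?thesis using Jpos s(2) by (simp add: field_simps)
  qed
  have "\<Union>G \<subseteq> {x\<in>space M. tree_maximal M T \<phi> x \<ge> ennreal lam}"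
  proof
    fix x assume "x \<in> \<Union>G"
    then obtain J where J: "J \<in> G" "x \<in> J" by blast
    then have JT: "J \<in> T" using G tree_level_subset[OF tree X] by blast
    have "ennreal lam \<le> tree_maximal M T \<phi> x"
      unfolding tree_maximal_def using JT J(2) avg[OF J(1)]
      by (intro SUP_upper2[of J]) (auto intro: ennreal_leI)
    then show "x \<in> {x\<in>space M. tree_maximal M T \<phi> x \<ge> ennreal lam}"
      using J(2) sets.sets_into_space[OF is_tree_sets[OF tree JT]] by auto
  qed
  moreover have "{x\<in>space M. tree_maximal M T \<phi> x \<ge> ennreal lam} \<in> sets M"
    using tree_maximal_measurable[OF tree, of \<phi>] by measurable
  ultimately have "s \<le> measure M {x\<in>space M. tree_maximal M T \<phi> x \<ge> ennreal lam}"
    unfolding s(1) by (rule finite_measure_mono)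
  then show thesis using that[of \<phi>] int nonneg norm by blast
qed

theorem theorem4p1:
  fixes M :: "'a measure" and T :: "'a set set" and C :: "'a set \<Rightarrow> 'a set set"
    and p k f F lam :: real
  assumes "prob_space M" and "non_atomic M" and "is_tree M T C"
    and "p > 1" and "k = p / (p - 1)"
    and "F > 0" and "0 < f" and "f \<le> k * F" and "lam > 0"
  shows "B1 M T p f F lam = min 1 (min (f / lam) (k powr p * F powr p / lam powr p))"
proof -
  interpret prob_space M by fact
  note tree = assms(3) and X = is_tree_space[OF assms(3)]
  define S where "S = {measure M {x\<in>space M. tree_maximal M T \<phi> x \<ge> ennreal lam} | \<phi>.
       integrable M \<phi> \<and> (\<forall>x\<in>space M. \<phi> x \<ge> 0) \<and> (\<integral>x. \<phi> x \<partial>M) = f \<and>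
       weak_Lp_norm M p \<phi> = ereal F}"
  define b where "b = min 1 (min (f / lam) (k powr p * F powr p / lam powr p))"
  have k: "0 < k" using assms(4,5) by simp
  have pow: "k powr p * F powr p / lam powr p = (k * F / lam) powr p"
    using k assms(6,9) by (simp add: powr_mult powr_divide)
  have b: "0 < b" "b \<le> 1" "b \<le> f / lam" "b \<le> (k * F / lam) powr p"
    using k assms(6,7,9) by (auto simp: b_def pow[symmetric])
  have upper: "v \<le> b" if "v \<in> S" for v
  proof -
    obtain \<phi> where v: "v = measure M {x\<in>space M. tree_maximal M T \<phi> x \<ge> ennreal lam}"
      and \<phi>: "integrable M \<phi>" "\<forall>x\<in>space M. \<phi> x \<ge> 0" "(\<integral>x. \<phi> x \<partial>M) = f"
      "weak_Lp_norm M p \<phi> = ereal F"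
      using \<open>v \<in> S\<close> unfolding S_def mem_Collect_eq by (elim exE conjE)
    have "(\<integral>x. \<bar>\<phi> x\<bar> \<partial>M) = (\<integral>x. \<phi> x \<partial>M)"
      using \<phi>(2) by (intro Bochner_Integration.integral_cong) auto
    then have "lam * v \<le> f"
      using tree_maximal_weak_type[OF finite_measure_axioms tree \<phi>(1) assms(9)] \<phi>(3) v by simp
    then have 1: "v \<le> f / lam" using assms(9) by (simp add: field_simps)
    have "lam * v powr (1/p) \<le> k * F"
      using tree_maximal_weak_Lp[OF finite_measure_axioms tree \<phi>(1) assms(9,4,6)] \<phi>(4) v assms(5) by simp
    then have "v powr (1/p) \<le> k * F / lam" using assms(9) by (simp add: field_simps)
    then have "(v powr (1/p)) powr p \<le> (k * F / lam) powr p"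
      using assms(4) by (intro powr_mono2) auto
    then have "v \<le> (k * F / lam) powr p" using assms(4) v by (simp add: powr_powr)
    then show ?thesis using 1 v by (simp add: b_def pow)
  qed
  then have bdd: "bdd_above S" by (rule bdd_aboveI)
  have lower: "\<exists>v\<in>S. b - e \<le> v" if e: "0 < e" for e
  proof -
    \<comment> \<open>The minimum with \<open>b\<close> keeps the measure
      \<open>s > b - \<delta>\<close> positive.\<close>
    define \<delta> where "\<delta> = min e b"
    have \<delta>: "0 < \<delta>" using e b by (simp add: \<delta>_def)
    obtain m where m: "\<And>J. J \<in> tree_level C (space M) m \<Longrightarrow> measure M J < \<delta>"
      using tree_level_measure_less[OF tree \<delta>] by blast
    \<comment> \<open>A full level has total mass \<open>1 \<ge> b\<close>, as
      \<open>subset_sum_near\<close> requires.\<close>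
    have "(\<Sum>J\<in>tree_level C (space M) m. measure M J) = 1"
      using measure_Union_level[OF finite_measure_axioms tree order_refl, of m]
        Union_tree_level[OF tree X, of m] prob_space by simp
    then obtain G where G: "G \<subseteq> tree_level C (space M) m"
      "b - \<delta> < sum (measure M) G" "sum (measure M) G \<le> b"
      using subset_sum_near[of "tree_level C (space M) m" "measure M" \<delta> b]
        finite_tree_level[OF tree X] m \<delta> b by auto
    define s where "s = measure M (\<Union>G)"
    have s: "b - \<delta> < s" "s \<le> b"
      using G measure_Union_level[OF finite_measure_axioms tree G(1)] by (auto simp: s_def)
    then have "0 < s" by (simp add: \<delta>_def)
    moreover have "s \<le> f / lam" "s \<le> (p / (p - 1) * F / lam) powr p"
      using s b unfolding assms(5) by auto
    ultimately obtain \<phi> :: "'a \<Rightarrow> real" where \<phi>: "integrable M \<phi>" "\<And>x. 0 \<le> \<phi> x" "(\<integral>x. \<phi> x \<partial>M) = f"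
      "weak_Lp_norm M p \<phi> = ereal F"
      and v: "s \<le> measure M {x\<in>space M. tree_maximal M T \<phi> x \<ge> ennreal lam}"
      using tree_maximal_extremal[OF assms(1) tree assms(4,6,7) assms(8)[unfolded assms(5)] assms(9) G(1) s_def]
      by blast
    have "measure M {x\<in>space M. tree_maximal M T \<phi> x \<ge> ennreal lam} \<in> S"
      unfolding S_def mem_Collect_eq by (intro exI[of _ \<phi>] conjI refl ballI \<phi>)
    moreover have "b - e \<le> s" using s by (simp add: \<delta>_def)
    ultimately show ?thesis using v by (meson order_trans)
  qed
  have "Sup S = b"
  proof (rule antisym)
    show "Sup S \<le> b"
      \<comment> \<open>\<open>lower\<close> is used here only to see that \<open>S\<close> is
        nonempty.\<close>
      using lower[of 1] upper by (intro cSup_least) auto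
    show "b \<le> Sup S"
    proof (rule field_le_epsilon)
      fix e :: real assume "0 < e"
      then obtain v where "v \<in> S" "b - e \<le> v" using lower by blast
      then show "b \<le> Sup S + e" using cSup_upper[OF _ bdd, of v] by simp
    qed
  qed
  then show ?thesis unfolding B1_def S_def b_def .
qed

end
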